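(* Let $R$ be a factorial domain, and $f\in{\rm Int}(R)^{\bullet}$. The following are equivalent: (1) Every $P\in\mathfrak{X}([\![f]\!])$ such that $P\cap R\neq\emptyset$ is principal. (2) For every $P\in\mathfrak{X}([\![f]\!])$ such that $P\cap R\neq\emptyset$ there is some $n\in\mathbb{N}$ such that $(P^n)_v$ is principal. (3) Every constant atom of $[\![f]\!]$ is a prime element of $[\![f]\!]$. (4) $d(gh)=d(g)d(h)$ for all $g,h\in[\![f]\!]$. Moreover, if $\mathcal{C}_v([\![f]\!])$ is finite, then these conditions are satisfied.
   Context: Monoids are commutative and cancellative with identity; for a domain $D$, $D^{\bullet}=D\setminus\{0\}$ is a multiplicative monoid. For a monoid $H$ with quotient group $L$: $\mathcal{A}(H)$ is the set of atoms. An $s$-ideal is a subset $I\subseteq H$ with $IH=I$ (the empty set is allowed); it is prime if $I\neq H$ and $H\setminus I$ is a submonoid. $\mathfrak{X}(H)$ is the set of minimal nonempty prime $s$-ideals of $H$. For $Y\subseteq L$ put $Y^{-1}=\{z\in L\mid zY\subseteq H\}$ and $Y_v=(Y^{-1})^{-1}$; $I$ is divisorial (a $v$-ideal) if $I_v=I$. For a Krull monoid $H$ (completely integrally closed Mori monoid), the divisor-class group $\mathcal{C}_v(H)$ is the group of nonempty fractional $v$-ideals under $(I,J)\mapsto(IJ)_v$ modulo principal fractional ideals. With $K$ a quotient field of $R$ and $X$ an indeterminate over $K$, ${\rm Int}(R)=\{g\in K[X]\mid g(x)\in R\text{ for all }x\in R\}$. For $f\in{\rm Int}(R)^{\bullet}$,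 $[\![f]\!]=\{g\in{\rm Int}(R)^{\bullet}\mid g\text{ divides }f^k\text{ in }{\rm Int}(R)\text{ for some }k\in\mathbb{N}_0\}$; it is known that $[\![f]\!]$ is a Krull monoid. The constant atoms of $[\![f]\!]$ are the elements of $\mathcal{A}([\![f]\!])\cap R$. Fix a system $\mathcal{Q}$ of representatives (up to associates) of the prime elements of $R$; for $p\in\mathcal{Q}$, $\mathrm{v}_p:R\to\mathbb{N}_0\cup\{\infty\}$ is the $p$-adic valuation, and $d:{\rm Int}(R)^{\bullet}\to R^{\bullet}$ is defined by $d(g)=\prod_{p\in\mathcal{Q}}p^{\min\{\mathrm{v}_p(g(c))\mid c\in R\}}$. *)

theory Defs
  imports
    "HOL-Algebra.Coset"
    "HOL-Algebra.Divisibility"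
    "HOL-Computational_Algebra.Polynomial_Factorial"
    "HOL-Library.Set_Algebras"
    "HOL-Library.Extended_Nat"
begin

section \<open>Commutative cancellative monoids and their divisorial ideals\<close>

text \<open>
  A monoid \<open>H\<close> is represented by its carrier, a set of nonzero elements of a field that contains
  1 and is closed under multiplication. Its quotient group is then a subgroup of the
  multiplicative group of the field. Products and powers of sets, and \<open>a *o H\<close>, are
  elementwise, as in \<open>Set_Algebras\<close>.
\<close>

definition mult_monoid :: "'k::field set \<Rightarrow> 'k monoid" where
  "mult_monoid H = \<lparr>carrier = H, mult = (*), one = 1\<rparr>"

definition atoms :: "'k::field set \<Rightarrow> 'k set" where
  "atoms H = {a \<in> H. Divisibility.irreducible (mult_monoid H) a}"

definition prime_elements :: "'k::field set \<Rightarrow> 'k set" where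
  "prime_elements H = {p \<in> H. Divisibility.prime (mult_monoid H) p}"

definition s_ideal :: "'k::field set \<Rightarrow> 'k set \<Rightarrow> bool" where
  "s_ideal H I \<longleftrightarrow> I \<subseteq> H \<and> I * H = I"

definition prime_s_ideal :: "'k::field set \<Rightarrow> 'k set \<Rightarrow> bool" where
  "prime_s_ideal H P \<longleftrightarrow> s_ideal H P \<and> P \<noteq> H \<and> submonoid (H - P) (mult_monoid H)"

definition minimal_primes :: "'k::field set \<Rightarrow> 'k set set" where
  "minimal_primes H = {P. prime_s_ideal H P \<and> P \<noteq> {} \<and>
     (\<forall>Q. prime_s_ideal H Q \<and> Q \<noteq> {} \<and> Q \<subseteq> P \<longrightarrow> Q = P)}"

definition principal_ideal :: "'k::field set \<Rightarrow> 'k set \<Rightarrow> bool" where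
  "principal_ideal H I \<longleftrightarrow> (\<exists>a\<in>H. I = a *o H)"

definition quotient_group :: "'k::field set \<Rightarrow> 'k set" where
  "quotient_group H = {a / b |a b. a \<in> H \<and> b \<in> H}"

definition ideal_inverse :: "'k::field set \<Rightarrow> 'k set \<Rightarrow> 'k set" where
  "ideal_inverse H Y = {z \<in> quotient_group H. z *o Y \<subseteq> H}"

definition v_closure :: "'k::field set \<Rightarrow> 'k set \<Rightarrow> 'k set" where
  "v_closure H Y = ideal_inverse H (ideal_inverse H Y)"

definition fractional_v_ideals :: "'k::field set \<Rightarrow> 'k set set" where
  "fractional_v_ideals H =
     {I. I \<subseteq> quotient_group H \<and> I \<noteq> {} \<and> (\<exists>c\<in>H. c *o I \<subseteq> H) \<and> v_closure H I = I}"

definition v_ideal_group :: "'k::field set \<Rightarrow> 'k set monoid" where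
  "v_ideal_group H =
     \<lparr>carrier = fractional_v_ideals H, mult = (\<lambda>I J. v_closure H (I * J)), one = H\<rparr>"

definition principal_fractional_ideals :: "'k::field set \<Rightarrow> 'k set set" where
  "principal_fractional_ideals H = {z *o H |z. z \<in> quotient_group H}"

text \<open>This is a group if \<open>H\<close> is completely integrally closed, in particular if \<open>H\<close> is Krull.\<close>

definition v_class_group :: "'k::field set \<Rightarrow> 'k set set monoid" where
  "v_class_group H = v_ideal_group H Mod principal_fractional_ideals H"


section \<open>Integer-valued polynomials\<close>

text \<open>\<open>R\<close> is the type \<open>'a\<close>, and \<open>K\<close> is \<open>'a fract\<close>.\<close>

definition int_valued :: "'a::idom fract poly set" where
  "int_valued = {g. \<forall>x. poly g (to_fract x) \<in> range to_fract}"

definition div_closed :: "'a::idom fract poly \<Rightarrow> 'a fract poly set" where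
  "div_closed f = {g \<in> int_valued - {0}. \<exists>k. \<exists>h\<in>int_valued. f ^ k = g * h}"

text \<open>
  The same monoid as a subset of the field \<open>K(X)\<close>, so that its quotient group is available,
  and the image of \<open>R\<close> in \<open>K(X)\<close>.
\<close>

definition div_closed_monoid :: "'a::idom fract poly \<Rightarrow> 'a fract poly fract set" where
  "div_closed_monoid f = to_fract ` div_closed f"

definition constants :: "'a::idom fract poly fract set" where
  "constants = range (\<lambda>r. to_fract [:to_fract r:])"


section \<open>Fixed divisors\<close>

definition prime_representatives :: "'a::comm_semiring_1 set \<Rightarrow> bool" where
  "prime_representatives Q \<longleftrightarrow>
     (\<forall>q\<in>Q. prime_elem q) \<and> (\<forall>p. prime_elem p \<longrightarrow> (\<exists>!q. q \<in> Q \<and> p dvd q \<and> q dvd p))"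

text \<open>The library's \<open>multiplicity p 0\<close> is 0, not infinity.\<close>

definition valuation :: "'a::factorial_semiring \<Rightarrow> 'a \<Rightarrow> enat" where
  "valuation p x = (if x = 0 then \<infinity> else enat (multiplicity p x))"

text \<open>
  For integer-valued \<open>g\<close>, \<open>the_inv to_fract\<close> turns the value \<open>g(c)\<close>, an element of \<open>K\<close>, into the
  corresponding element of \<open>R\<close>. If \<open>g\<close> is nonzero and \<open>R\<close> has a prime element, then \<open>R\<close> is
  infinite, so \<open>g\<close> does not vanish on \<open>R\<close> and the minimum is finite.
\<close>

definition fixed_divisor_exponent ::
    "'a::{factorial_semiring,idom} \<Rightarrow> 'a fract poly \<Rightarrow> nat" where
  "fixed_divisor_exponent p g =
     the_enat (INF c. valuation p (the_inv to_fract (poly g (to_fract c))))"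

text \<open>
  The product is restricted to the finitely many primes with nonzero exponent, since \<open>\<Prod>\<close> over
  an infinite set is 1 by convention.
\<close>

definition fixed_divisor ::
    "'a::{factorial_semiring,idom} set \<Rightarrow> 'a fract poly \<Rightarrow> 'a" where
  "fixed_divisor Q g =
     (\<Prod>p\<in>{p \<in> Q. fixed_divisor_exponent p g \<noteq> 0}. p ^ fixed_divisor_exponent p g)"

end

theory Submission
  imports Defs
begin

text \<open>
  A prime \<open>p\<close> of \<open>R\<close> in \<open>H = [[f]]\<close> divides \<open>g\<close> in \<open>H\<close> iff \<open>p\<close> divides all values \<open>g(c)\<close>, so \<open>pH\<close> is a
  radical ideal. It has an associated prime \<open>P = {x. p dvd b * x}\<close>, by a multiplicative dependence
  argument in \<open>K[X]\<close>, and since \<open>H\<close> is completely integrally closed, \<open>P\<close> is a minimal nonempty prime.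
  If some \<open>(P^n)\<^sub>v\<close> is principal, or if the class group is finite, then \<open>P^n \<subseteq> aH\<close> for some nonunit \<open>a\<close>
  dividing a power of \<open>p\<close>; hence \<open>P^n \<subseteq> pH\<close>, and as \<open>pH\<close> is radical, \<open>P = pH\<close> and \<open>p\<close> is prime in \<open>H\<close>.
  Finally, the exponent of \<open>p\<close> in \<open>d(g)\<close> is the largest \<open>k\<close> with \<open>p^k\<close> dividing \<open>g\<close> in \<open>H\<close>, which is additive
  in \<open>g\<close> iff \<open>p\<close> is prime in \<open>H\<close>.
\<close>

section \<open>Completely integrally closed monoids\<close>

text \<open>A chain condition is needed only for the ideals \<open>{x. p dvd b * x}\<close>. It
  comes from K[X]: members of \<open>H\<close> divide powers of \<open>f\<close>, so up to constants
  they are built from finitely many primes. The fraction \<open>z = b / p\<close> multiplies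
  \<open>P\<close> into \<open>H\<close> without lying in \<open>H\<close>; by complete integral
  closedness it stabilises no nonempty subset of \<open>H\<close>. This yields the minimality of
  \<open>P\<close>, and also the nonunit \<open>a\<close> for a finite class group, where the
  closures of two powers of \<open>P\<close> have the same class by pigeonhole. A divisor in
  \<open>H\<close> of a power of \<open>p\<close> has degree 0, so it is a constant, and arithmetic
  in \<open>R\<close> shows that \<open>p\<close> divides it unless it is a unit. The conditions
  meet in one statement: every prime of \<open>R\<close> lying in \<open>H\<close> is a prime
  element of \<open>H\<close>. Primes of \<open>R\<close> are the right constants because
  factorizations of constants stay in \<open>R\<close>, and a prime ideal of \<open>H\<close>
  meeting \<open>R\<close> contains a prime of \<open>R\<close>.\<close>

locale field_monoid =
  fixes H :: "'k::field set"
  assumes one_in [simp]: "1 \<in> H"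
    and mult_in [intro]: "a \<in> H \<Longrightarrow> b \<in> H \<Longrightarrow> a * b \<in> H"
    and zero_notin [simp]: "0 \<notin> H"
begin

abbreviation L where "L \<equiv> quotient_group H"
abbreviation ii where "ii \<equiv> ideal_inverse H"
abbreviation vc where "vc \<equiv> v_closure H"

lemma subset_quotient_group: "H \<subseteq> L"
  unfolding quotient_group_def by (metis (mono_tags, lifting) div_by_1 mem_Collect_eq one_in subsetI)

lemma quotient_group_mult: "x \<in> L \<Longrightarrow> y \<in> L \<Longrightarrow> x * y \<in> L"
  unfolding quotient_group_def by (clarsimp, metis mult_in)

lemma quotient_group_inverse: "x \<in> L \<Longrightarrow> inverse x \<in> L"
  unfolding quotient_group_def by (clarsimp, metis)

lemma quotient_group_nonzero: "x \<in> L \<Longrightarrow> x \<noteq> 0"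
  unfolding quotient_group_def by auto

lemma one_in_quotient_group: "1 \<in> L"
  using subset_quotient_group by auto

section \<open>Inverses and divisorial closure\<close>

lemma mem_ideal_inverse: "y \<in> ii A \<longleftrightarrow> y \<in> L \<and> (\<forall>a\<in>A. y * a \<in> H)"
  by (auto simp: ideal_inverse_def elt_set_times_def)

lemma mem_v_closure: "x \<in> vc A \<longleftrightarrow> x \<in> L \<and> (\<forall>y\<in>ii A. x * y \<in> H)"
  by (simp add: v_closure_def mem_ideal_inverse)

lemma v_closure_mono: "A \<subseteq> B \<Longrightarrow> vc A \<subseteq> vc B"
  by (auto simp: mem_v_closure mem_ideal_inverse subset_iff)

lemma v_closure_extensive:
  assumes "A \<subseteq> L" shows "A \<subseteq> vc A"
proof
  fix x assume "x \<in> A"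
  moreover from this have "x * y \<in> H" if "y \<in> ii A" for y
    using that by (auto simp: mem_ideal_inverse mult.commute[of x])
  ultimately show "x \<in> vc A" using assms by (auto simp: mem_v_closure)
qed

lemma v_closure_subset: "vc A \<subseteq> L"
  by (auto simp: mem_v_closure)

lemma v_closure_idem:
  assumes "A \<subseteq> L" shows "vc (vc A) = vc A"
proof
  have "ii A \<subseteq> ii (vc A)"
    by (metis mem_ideal_inverse mem_v_closure mult.commute subsetI)
  then show "vc (vc A) \<subseteq> vc A" by (meson mem_v_closure subset_iff)
  show "vc A \<subseteq> vc (vc A)" by (rule v_closure_extensive[OF v_closure_subset])
qed

lemma v_closure_principal:
  assumes z: "z \<in> L" shows "vc (z *o H) = z *o H"
proof
  have nz: "z \<noteq> 0" using quotient_group_nonzero[OF z] .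
  have "inverse z \<in> ii (z *o H)"
    using nz quotient_group_inverse[OF z] by (auto simp: mem_ideal_inverse elt_set_times_def simp flip: mult.assoc)
  then have "x * inverse z \<in> H" if "x \<in> vc (z *o H)" for x
    using that by (auto simp: mem_v_closure)
  moreover have "x = z * (x * inverse z)" for x using nz by simp
  ultimately show "vc (z *o H) \<subseteq> z *o H"
    unfolding elt_set_times_def by blast
  show "z *o H \<subseteq> vc (z *o H)"
    by (rule v_closure_extensive)
       (use z subset_quotient_group quotient_group_mult in \<open>auto simp: elt_set_times_def\<close>)
qed

lemma one_coset: "1 *o H = H"
  by (simp add: elt_set_times_def)

lemma v_closure_carrier: "vc H = H"
  using v_closure_principal[OF one_in_quotient_group] by (simp add: one_coset)

text \<open>An element \<open>y\<close> of the inverse of the scaled set gives the element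
  \<open>y * z\<close> of the inverse of \<open>A\<close>.\<close>

lemma v_closure_scale:
  assumes "z \<in> L" "x \<in> vc A" shows "z * x \<in> vc (z *o A)"
proof -
  have "z * x * y \<in> H" if "y \<in> ii (z *o A)" for y
  proof -
    have "y * z \<in> ii A"
      using that assms(1) quotient_group_mult
      by (auto simp: mem_ideal_inverse elt_set_times_def mult.assoc)
    then show ?thesis using assms(2) by (auto simp: mem_v_closure mult_ac)
  qed
  then show ?thesis using assms quotient_group_mult by (auto simp: mem_v_closure)
qed

section \<open>s-ideals, prime ideals and elementwise powers\<close>

lemma s_ideal_iff: "s_ideal H I \<longleftrightarrow> I \<subseteq> H \<and> (\<forall>x\<in>I. \<forall>h\<in>H. x * h \<in> I)"
proof -
  have "I \<subseteq> I * H" 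
    by (metis mult.right_neutral one_in set_times_intro subsetI)
  then show ?thesis unfolding s_ideal_def by (auto elim!: set_times_elim)
qed

text \<open>For an s-ideal, \<open>1 \<notin> P\<close> covers both \<open>P \<noteq> H\<close> and
  the identity of the complement.\<close>

lemma prime_s_ideal_iff:
  "prime_s_ideal H P \<longleftrightarrow> P \<subseteq> H \<and> (\<forall>x\<in>P. \<forall>h\<in>H. x * h \<in> P) \<and> 1 \<notin> P \<and>
     (\<forall>x\<in>H. \<forall>y\<in>H. x * y \<in> P \<longrightarrow> x \<in> P \<or> y \<in> P)"
  unfolding prime_s_ideal_def s_ideal_iff
  by (auto simp: mult_monoid_def submonoid_def dest: mult_in)

lemma s_ideal_v_closure:
  assumes "A \<subseteq> H" shows "s_ideal H (vc A)"
  unfolding s_ideal_iff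
proof (intro conjI ballI)
  show "vc A \<subseteq> H" using v_closure_mono[OF assms] v_closure_carrier by simp
  fix x h assume x: "x \<in> vc A" and h: "h \<in> H"
  have "x * h \<in> L" using x h v_closure_subset subset_quotient_group quotient_group_mult by blast
  moreover have "x * h * y \<in> H" if "y \<in> ii A" for y
    using x h that mult_in[of h "x * y"] by (auto simp: mem_v_closure mult_ac)
  ultimately show "x * h \<in> vc A" by (simp add: mem_v_closure)
qed

lemma s_ideal_times:
  assumes I: "s_ideal H I" and B: "B \<subseteq> H" shows "s_ideal H (I * B)"
  unfolding s_ideal_iff
proof (intro conjI ballI)
  show "I * B \<subseteq> H" using I B by (auto simp: s_ideal_iff elim!: set_times_elim)
  fix x h assume "x \<in> I * B" and h: "h \<in> H"
  then obtain a b where ab: "x = a * b" "a \<in> I" "b \<in> B" by (elim set_times_elim)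
  then have "(a * h) * b \<in> I * B" using I h by (intro set_times_intro) (auto simp: s_ideal_iff)
  then show "x * h \<in> I * B" using ab(1) by (simp add: mult_ac)
qed

lemma power_subset:
  assumes "I \<subseteq> H" shows "I ^ n \<subseteq> H"
proof (induction n)
  case 0
  then show ?case by simp
next
  case (Suc n)
  then show ?case using assms by (auto elim!: set_times_elim)
qed

text \<open>The exponent starts at 1: the elementwise power \<open>I ^ 0\<close> is
  \<open>{1}\<close>, in general not an s-ideal.\<close>

lemma s_ideal_power_Suc: "s_ideal H I \<Longrightarrow> s_ideal H (I ^ Suc n)"
  using s_ideal_times power_subset by (simp add: s_ideal_iff[of I])

lemma s_ideal_power_antimono:
  assumes "s_ideal H I" "m \<le> n" shows "I ^ Suc n \<subseteq> I ^ Suc m"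
proof -
  have "I ^ Suc n = I ^ (Suc m + (n - m))" using assms(2) by (metis add_Suc le_add_diff_inverse)
  also have "\<dots> = I ^ Suc m * I ^ (n - m)" by (rule power_add)
  also have "\<dots> \<subseteq> I ^ Suc m * H"
    using assms(1) power_subset[of I "n - m"] by (intro set_times_mono2) (auto simp: s_ideal_iff)
  also have "\<dots> = I ^ Suc m"
    using s_ideal_power_Suc[OF assms(1), of m] unfolding s_ideal_def by blast
  finally show ?thesis .
qed

lemma mem_power: "x \<in> I \<Longrightarrow> x ^ n \<in> I ^ n"
  by (induction n) auto

lemma prime_elements_iff:
  "p \<in> prime_elements H \<longleftrightarrow> p \<in> H \<and> prime_s_ideal H (p *o H)"
proof (cases "p \<in> H")
  case True
  have un: "p \<in> Units (mult_monoid H) \<longleftrightarrow> 1 \<in> p *o H"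
    using True by (auto simp: Units_def mult_monoid_def elt_set_times_def mult.commute)
  have dv: "p divides\<^bsub>mult_monoid H\<^esub> x \<longleftrightarrow> x \<in> p *o H" for x
    by (auto simp: factor_def mult_monoid_def elt_set_times_def)
  have "p *o H \<subseteq> H" "\<forall>x\<in>p *o H. \<forall>h\<in>H. x * h \<in> p *o H"
    using True by (auto simp: elt_set_times_def mult.assoc)
  then show ?thesis
    using True unfolding prime_elements_def Divisibility.prime_def prime_s_ideal_iff
    by (auto simp: un dv) (auto simp: mult_monoid_def)
qed (auto simp: prime_elements_def)

text \<open>\<open>p *o H\<close> is a nonempty prime s-ideal inside \<open>P\<close>, so minimality
  forces equality.\<close>

lemma principal_of_prime_element:
  assumes "P \<in> minimal_primes H" "p \<in> P" "p \<in> prime_elements H"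
  shows "principal_ideal H P"
proof -
  have "p \<in> p *o H" by (auto simp: elt_set_times_def intro: bexI[of _ 1])
  moreover have "p *o H \<subseteq> P"
    using assms(1,2) by (auto simp: minimal_primes_def prime_s_ideal_iff elt_set_times_def)
  ultimately have "p *o H = P"
    using assms unfolding minimal_primes_def prime_elements_iff by blast
  then show ?thesis using assms(3) by (auto simp: principal_ideal_def prime_elements_iff)
qed

end

text \<open>\<open>c\<close> is a common denominator of all powers of \<open>z\<close>; elements
  with such a denominator are the almost integral ones.\<close>

locale cic_monoid = field_monoid +
  assumes cic: "z \<in> L \<Longrightarrow> c \<in> H \<Longrightarrow> (\<And>n. c * z ^ n \<in> H) \<Longrightarrow> z \<in> H"
begin

text \<open>A stable set contains \<open>c * z ^ n\<close> for each of its elements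
  \<open>c\<close>, so \<open>c\<close> witnesses that \<open>z\<close> is almost integral.\<close>

lemma cic_stable:
  assumes "z \<in> L" "A \<subseteq> H" "A \<noteq> {}" "\<And>x. x \<in> A \<Longrightarrow> z * x \<in> A"
  shows "z \<in> H"
proof -
  obtain c where c: "c \<in> A" using assms(3) by auto
  have "c * z ^ n \<in> A" for n
    by (induction n) (use c assms(4) in \<open>simp_all add: mult.left_commute[of c z]\<close>)
  then show ?thesis using cic[OF assms(1)] c assms(2) by blast
qed

text \<open>Krull's principal ideal theorem for associated primes: outside \<open>P\<close>, the ideal \<open>P\<close> becomes
  principal, generated by any \<open>x \<in> P\<close> with \<open>z * x \<notin> P\<close>.\<close>

lemma associated_prime_minimal:
  assumes z: "z \<in> L" "z \<notin> H" and P: "P = {x \<in> H. z * x \<in> H}"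
    and pr: "prime_s_ideal H P" and ne: "P \<noteq> {}"
  shows "P \<in> minimal_primes H"
proof -
  have "P \<subseteq> Q" if Q: "prime_s_ideal H Q" "Q \<noteq> {}" "Q \<subseteq> P" for Q
  proof -
    note Qp = Q(1)[unfolded prime_s_ideal_iff]
    \<comment> \<open>Otherwise \<open>z\<close> would stabilise \<open>P\<close> and lie in
      \<open>H\<close>.\<close>
    have "\<exists>x\<in>P. z * x \<notin> P"
      using cic_stable[OF z(1), of P] z(2) ne P by blast
    then obtain x where x: "x \<in> P" "z * x \<notin> P" ..
    have xH: "x \<in> H" and uH: "z * x \<in> H" using x(1) P by auto
    have "x \<in> Q"
    proof (rule ccontr)
      assume nx: "x \<notin> Q"
      \<comment> \<open>As \<open>x\<close> is outside the prime \<open>Q\<close>, it can be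
        cancelled from \<open>(z * q) * x = q * (z * x)\<close>; so \<open>z\<close> would stabilise
        \<open>Q\<close>.\<close>
      have "z * q \<in> Q" if q: "q \<in> Q" for q
      proof -
        have "z * q \<in> H" using q Q(3) P by auto
        moreover have "q * (z * x) \<in> Q" using q uH Qp by blast
        then have "(z * q) * x \<in> Q" by (simp add: mult_ac)
        ultimately show ?thesis using nx xH Qp by blast
      qed
      then have "z \<in> H" using cic_stable[OF z(1), of Q] Q(2) Qp by blast
      then show False using z(2) by simp
    qed
    show "P \<subseteq> Q"
    proof
      fix y assume y: "y \<in> P"
      then have "z * y \<in> H" "y \<in> H" using P by auto
      then have "x * (z * y) \<in> Q" using \<open>x \<in> Q\<close> Qp by blast
      \<comment> \<open>\<open>z * x\<close> is outside \<open>P\<close>, hence outside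
        \<open>Q\<close>, so primality of \<open>Q\<close> leaves \<open>y\<close>.\<close>
      then have "y * (z * x) \<in> Q" by (simp add: mult_ac)
      then show "y \<in> Q" using \<open>y \<in> H\<close> uH x(2) Q(3) Qp by blast
    qed
  qed
  then show ?thesis using pr ne unfolding minimal_primes_def by blast
qed

text \<open>\<open>P ^ n\<close> lies in \<open>P\<close>, so \<open>y\<close> is also in its
  inverse; as \<open>y \<notin> H\<close>, the closure of \<open>P ^ n\<close> omits 1, and its
  generator is not a unit.\<close>

lemma nonunit_bound_if_principal:
  assumes P: "s_ideal H P" and y: "y \<in> L" "y \<notin> H" "\<forall>x\<in>P. y * x \<in> H"
    and n: "n \<ge> 1" "principal_ideal H (vc (P ^ n))"
  shows "\<exists>a\<in>H. 1 \<notin> a *o H \<and> P ^ n \<subseteq> a *o H"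
proof -
  obtain m where m: "n = Suc m" using n(1) by (cases n) auto
  obtain a where a: "a \<in> H" "vc (P ^ n) = a *o H" using n(2) by (auto simp: principal_ideal_def)
  have PL: "P ^ n \<subseteq> L"
    using P power_subset[of P n] subset_quotient_group by (auto simp: s_ideal_iff)
  have "P ^ n \<subseteq> P" using s_ideal_power_antimono[OF P, of 0 m] m by (simp del: set_one)
  then have "y \<in> ii (P ^ n)" using y by (auto simp: mem_ideal_inverse)
  then have "1 \<notin> vc (P ^ n)" using y(2) by (auto simp: mem_v_closure)
  then show ?thesis using a v_closure_extensive[OF PL] by auto
qed

text \<open>For closures \<open>I n\<close> of \<open>P ^ Suc n\<close>, pigeonhole gives
  \<open>i < j\<close> such that \<open>I j\<close> is the closure of \<open>I i\<close> scaled by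
  some \<open>z\<close>. Since \<open>z\<close> maps \<open>I i\<close> into
  \<open>I j \<subseteq> I i\<close>, it lies in \<open>H\<close>. It is the sought nonunit: a unit
  would give \<open>I i \<subseteq> I j\<close>, and then \<open>y\<close> would stabilise
  \<open>I j\<close>.\<close>

lemma nonunit_bound_if_finite_class_group:
  assumes P: "s_ideal H P" "P \<noteq> {}" and y: "y \<in> L" "y \<notin> H" "\<forall>x\<in>P. y * x \<in> H"
    and fin: "finite (carrier (v_class_group H))"
  shows "\<exists>n\<ge>1. \<exists>a\<in>H. 1 \<notin> a *o H \<and> P ^ n \<subseteq> a *o H"
proof -
  define I where "I n = vc (P ^ Suc n)" for n
  have PH: "P ^ n \<subseteq> H" for n using P(1) power_subset by (simp add: s_ideal_iff)
  have ext: "P ^ Suc n \<subseteq> I n" for n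
    unfolding I_def by (rule v_closure_extensive) (use PH subset_quotient_group in blast)
  have IH: "I n \<subseteq> H" for n
    unfolding I_def using v_closure_mono[OF PH] v_closure_carrier by metis
  have Ine: "I n \<noteq> {}" for n
    using ext[of n] P(2) mem_power[of _ P "Suc n"] by blast
  have anti: "I n \<subseteq> I m" if "m \<le> n" for m n
    unfolding I_def by (rule v_closure_mono[OF s_ideal_power_antimono[OF P(1) that]])
  have vI: "vc (I n) = I n" for n
    unfolding I_def by (rule v_closure_idem) (use PH subset_quotient_group in blast)
  let ?G = "v_ideal_group H" and ?N = "principal_fractional_ideals H"
  have Iv: "I n \<in> fractional_v_ideals H" for n
    unfolding fractional_v_ideals_def
  proof (safe)
    show "\<exists>c\<in>H. c *o I n \<subseteq> H" using IH by (intro bexI[of _ 1]) (auto simp: elt_set_times_def)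
    { fix x assume "x \<in> vc (I n)" then show "x \<in> I n" using vI by simp }
    { fix x assume "x \<in> I n" then show "x \<in> vc (I n)" using vI by simp }
  qed (use Ine IH subset_quotient_group in \<open>auto\<close>)
  have coset: "(?N #>\<^bsub>?G\<^esub> I n) = {vc ((z *o H) * I n) |z. z \<in> L}" for n
    by (auto simp: r_coset_def v_ideal_group_def principal_fractional_ideals_def)
  have "(?N #>\<^bsub>?G\<^esub> I n) \<in> carrier (v_class_group H)" for n
    using Iv by (auto simp: v_class_group_def FactGroup_def RCOSETS_def v_ideal_group_def)
  then have "finite (range (\<lambda>n. ?N #>\<^bsub>?G\<^esub> I n))"
    using fin by (meson finite_subset image_subsetI)
  then have "\<not> inj (\<lambda>n. ?N #>\<^bsub>?G\<^esub> I n)"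
    using finite_imageD infinite_UNIV_nat by blast
  then obtain i j where ij: "i < j" "(?N #>\<^bsub>?G\<^esub> I i) = (?N #>\<^bsub>?G\<^esub> I j)"
    unfolding inj_def by (metis linorder_neqE_nat)
  have "(1 *o H) * I j = I j"
    using s_ideal_v_closure[OF PH, of "Suc j"] by (simp add: s_ideal_def one_coset I_def mult.commute)
  \<comment> \<open>Equality of the two cosets transports this membership: \<open>I j\<close> is
    then also the closure of a multiple of \<open>I i\<close>.\<close>
  then have "I j \<in> (?N #>\<^bsub>?G\<^esub> I j)"
    unfolding coset using one_in_quotient_group vI by (auto intro!: exI[of _ 1])
  then obtain z where z: "z \<in> L" "I j = vc ((z *o H) * I i)"
    unfolding ij(2)[symmetric] unfolding coset by blast
  have "H * I i \<subseteq> H" using IH[of i] by (auto elim!: set_times_elim)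
  then have sub_z: "(z *o H) * I i \<subseteq> z *o H"
    unfolding set_times_rearrange3 by (rule set_times_mono)
  then have Ijz: "I j \<subseteq> z *o H"
    using v_closure_mono v_closure_principal[OF z(1)] z(2) by metis
  have "z *o H \<subseteq> L"
    using z(1) subset_quotient_group quotient_group_mult by (auto simp: elt_set_times_def)
  then have sub: "(z *o H) * I i \<subseteq> I j"
    using v_closure_extensive z(2) sub_z by blast
  have zI: "z * h * x \<in> I j" if "x \<in> I i" "h \<in> H" for x h
    using sub that by (auto simp: elt_set_times_def set_times_def)
  have zH: "z \<in> H"
    using cic_stable[OF z(1) IH Ine, of i] zI[of _ 1] anti[of i j] ij(1) by auto
  have "1 \<notin> z *o H"
  proof
    assume "1 \<in> z *o H"
    then obtain h where h: "h \<in> H" "z * h = 1" by (auto simp: elt_set_times_def)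
    have Iij: "I i \<subseteq> I j" using zI[OF _ h(1)] h(2) by auto
    \<comment> \<open>\<open>y\<close> lowers the power of \<open>P\<close> by one:
      \<open>I j\<close> lies in \<open>I (Suc i)\<close>, which \<open>y\<close> maps into
      \<open>I i\<close>, and this lies in \<open>I j\<close>.\<close>
    have "y * x \<in> I j" if x: "x \<in> I j" for x
    proof -
      have "x \<in> vc (P ^ Suc (Suc i))" using anti[of "Suc i" j] ij(1) x unfolding I_def by auto
      then have "y * x \<in> vc (y *o (P ^ Suc (Suc i)))" by (rule v_closure_scale[OF y(1)])
      moreover have "y *o (P ^ Suc (Suc i)) \<subseteq> P ^ Suc i"
      proof
        fix w assume "w \<in> y *o (P ^ Suc (Suc i))"
        then obtain a b where ab: "a \<in> P" "b \<in> P ^ Suc i" "w = y * (a * b)"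
          unfolding power_Suc[of P "Suc i"] by (auto simp: elt_set_times_def elim: set_times_elim)
        then have "w = b * (y * a)" by (simp add: mult_ac)
        moreover have "b * (y * a) \<in> P ^ Suc i"
          using s_ideal_power_Suc[OF P(1), of i] ab(1,2) y(3) unfolding s_ideal_iff by blast
        ultimately show "w \<in> P ^ Suc i" by simp
      qed
      ultimately have "y * x \<in> vc (P ^ Suc i)" using v_closure_mono by blast
      then have "y * x \<in> I i" unfolding I_def .
      then show ?thesis using Iij by blast
    qed
    then have "y \<in> H" using cic_stable[OF y(1) IH Ine] by blast
    then show False using y(2) by simp
  qed
  moreover have "P ^ Suc j \<subseteq> z *o H" using ext Ijz by blast
  ultimately show ?thesis using zH by (intro exI[of _ "Suc j"]) auto
qed

text \<open>Separates the monoid argument from polynomials: \<open>mx\<close> makes the ideal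
  quotient of \<open>p *o H\<close> by \<open>b\<close> prime, \<open>alt\<close> bounds one of its
  powers, and \<open>rad\<close> and \<open>div\<close> turn this bound into equality with
  \<open>p *o H\<close>.\<close>

lemma prime_element_of_associated_prime:
  assumes p: "p \<in> H" and b: "b \<in> H" "b \<notin> p *o H"
    and rad: "\<And>x n. x \<in> H \<Longrightarrow> x ^ n \<in> p *o H \<Longrightarrow> x \<in> p *o H"
    and div: "\<And>a n. a \<in> H \<Longrightarrow> p ^ n \<in> a *o H \<Longrightarrow> 1 \<notin> a *o H \<Longrightarrow> a \<in> p *o H"
    and mx: "\<And>x y. x \<in> H \<Longrightarrow> y \<in> H \<Longrightarrow> b * x \<notin> p *o H \<Longrightarrow> b * x * y \<in> p *o H \<Longrightarrow> b * y \<in> p *o H"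
    and alt: "finite (carrier (v_class_group H)) \<or>
      (\<forall>P\<in>minimal_primes H. p \<in> P \<longrightarrow> (\<exists>n::nat. n \<ge> 1 \<and> principal_ideal H (v_closure H (P ^ n))))"
  shows "p \<in> prime_elements H"
proof -
  \<comment> \<open>The fraction turns \<open>b * x \<in> p *o H\<close> into
    \<open>z * x \<in> H\<close>, the shape to which complete integral closedness applies.\<close>
  define z where "z = b / p"
  define P where "P = {x \<in> H. z * x \<in> H}"
  have p0: "p \<noteq> 0" using p zero_notin by metis
  have mem: "b * x \<in> p *o H \<longleftrightarrow> z * x \<in> H" for x
  proof
    assume "b * x \<in> p *o H"
    then obtain h where "h \<in> H" "b * x = p * h" by (auto simp: elt_set_times_def)
    then show "z * x \<in> H" using p0 by (simp add: z_def)
  next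
    assume "z * x \<in> H"
    moreover have "b * x = p * (z * x)" using p0 by (simp add: z_def)
    ultimately show "b * x \<in> p *o H" by (auto simp: elt_set_times_def)
  qed
  have zL: "z \<in> L" using p b by (auto simp: quotient_group_def z_def)
  have zH: "z \<notin> H" using mem[of 1] b(2) by auto
  have pP: "p *o H \<subseteq> P"
    using p b p0 by (auto simp: P_def elt_set_times_def z_def)
  have pp: "p \<in> p *o H" by (auto simp: elt_set_times_def intro: bexI[of _ 1])
  have prP: "prime_s_ideal H P"
    unfolding prime_s_ideal_iff
  proof (intro conjI ballI impI)
    fix x y assume xy: "x \<in> H" "y \<in> H" "x * y \<in> P"
    show "x \<in> P \<or> y \<in> P"
      using mx[OF xy(1,2)] xy mem[of x] mem[of y] mem[of "x * y"] by (auto simp: P_def mult.assoc)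
  next
    fix x h assume "x \<in> P" "h \<in> H"
    then have "x \<in> H" "z * x * h \<in> H" "h \<in> H" unfolding P_def by blast+
    then show "x * h \<in> P" by (auto simp: P_def mult.assoc)
  qed (use zH in \<open>auto simp: P_def\<close>)
  have ne: "P \<noteq> {}" using pP pp by blast
  have sP: "s_ideal H P" using prP by (simp add: prime_s_ideal_def)
  have min: "P \<in> minimal_primes H"
    by (rule associated_prime_minimal[OF zL zH P_def prP ne])
  have yP: "\<forall>x\<in>P. z * x \<in> H" by (simp add: P_def)
  have "\<exists>n\<ge>1. \<exists>a\<in>H. 1 \<notin> a *o H \<and> P ^ n \<subseteq> a *o H"
    using alt
  proof
    assume "finite (carrier (v_class_group H))"
    then show ?thesis by (rule nonunit_bound_if_finite_class_group[OF sP ne zL zH yP])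
  next
    assume "\<forall>P\<in>minimal_primes H. p \<in> P \<longrightarrow> (\<exists>n\<ge>1. principal_ideal H (vc (P ^ n)))"
    then obtain n where n: "n \<ge> 1" "principal_ideal H (vc (P ^ n))"
      using min pP pp by blast
    show ?thesis using nonunit_bound_if_principal[OF sP zL zH yP n] n(1) by (intro exI[of _ n]) simp
  qed
  then obtain n a where na: "a \<in> H" "1 \<notin> a *o H" "P ^ n \<subseteq> a *o H" by blast
  have "p ^ n \<in> a *o H" using na(3) mem_power[of p P n] pP pp by blast
  then have ap: "a \<in> p *o H" using div[OF na(1) _ na(2)] by blast
  have "a *o H \<subseteq> p *o H" using ap by (auto simp: elt_set_times_def mult.assoc)
  have "x \<in> p *o H" if "x \<in> P" for x
  proof (rule rad)
    show "x \<in> H" using that by (simp add: P_def)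
    show "x ^ n \<in> p *o H"
      using mem_power[OF that, of n] na(3) \<open>a *o H \<subseteq> p *o H\<close> by blast
  qed
  then have "P = p *o H" using pP by blast
  then show ?thesis unfolding prime_elements_iff using p prP by metis
qed

end

section \<open>Multiplicative dependence of polynomials\<close>

text \<open>Fraction-free Gaussian elimination: each coordinate in \<open>S\<close> costs at most
  one pivot row.\<close>

lemma int_linear_dependence:
  fixes e :: "'i \<Rightarrow> 'b \<Rightarrow> int"
  assumes "finite S" "finite I" "card S < card I"
  shows "\<exists>s. (\<exists>i\<in>I. s i \<noteq> 0) \<and> (\<forall>q\<in>S. (\<Sum>i\<in>I. s i * e i q) = 0)"
  using assms
proof (induction S arbitrary: I e rule: finite_induct)
  case empty
  then have "I \<noteq> {}" by auto
  then show ?case by (intro exI[of _ "\<lambda>_. 1"]) auto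
next
  case (insert b S)
  show ?case
  proof (cases "\<forall>i\<in>I. e i b = 0")
    case True
    have "card S < card I" using insert by simp
    then obtain s where "\<exists>i\<in>I. s i \<noteq> 0" "\<forall>q\<in>S. (\<Sum>i\<in>I. s i * e i q) = 0"
      using insert.IH[OF insert.prems(1)] by blast
    then show ?thesis using True by (intro exI[of _ s]) auto
  next
    case False
    then obtain k where k: "k \<in> I" "e k b \<noteq> 0" by blast
    \<comment> \<open>A multiple of the pivot row \<open>k\<close> clears coordinate
      \<open>b\<close>; scaling by \<open>e k b\<close> keeps the entries integral.\<close>
    define d where "d i q = e k b * e i q - e i b * e k q" for i q
    have "finite (I - {k})" "card S < card (I - {k})" using insert k by auto
    then obtain s where s: "\<exists>i\<in>I - {k}. s i \<noteq> 0" "\<forall>q\<in>S. (\<Sum>i\<in>I - {k}. s i * d i q) = 0"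
      using insert.IH by blast
    \<comment> \<open>The coefficient at \<open>k\<close> collects the pivot multiples contained in
      \<open>d\<close>, so a relation among the \<open>d i\<close> becomes one among the
      \<open>e i\<close>.\<close>
    define t where "t i = (if i = k then - (\<Sum>j\<in>I - {k}. s j * e j b) else e k b * s i)" for i
    have "\<exists>i\<in>I. t i \<noteq> 0" using s(1) k(2) by (auto simp: t_def)
    moreover have eq: "(\<Sum>i\<in>I. t i * e i q) = (\<Sum>i\<in>I - {k}. s i * d i q)" for q
    proof -
      have "(\<Sum>i\<in>I. t i * e i q) = t k * e k q + (\<Sum>i\<in>I - {k}. t i * e i q)"
        using insert.prems(1) k(1) by (rule sum.remove)
      also have "(\<Sum>i\<in>I - {k}. t i * e i q) = (\<Sum>i\<in>I - {k}. e k b * s i * e i q)"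
        by (rule sum.cong) (auto simp: t_def)
      also have "t k * e k q = - (\<Sum>j\<in>I - {k}. s j * e j b * e k q)"
        by (simp add: t_def sum_distrib_right)
      finally show ?thesis by (simp add: d_def right_diff_distrib sum_subtractf mult_ac)
    qed
    moreover have "(\<Sum>i\<in>I. t i * e i q) = 0" if "q \<in> insert b S" for q
      using that s(2) unfolding eq by (auto simp: d_def)
    ultimately show ?thesis by blast
  qed
qed

section \<open>Divisibility by products of primes in a domain\<close>

lemma prime_power_dvd_multD:
  fixes p :: "'b::idom"
  assumes "prime_elem p" "\<not> p dvd y" "p ^ n dvd x * y"
  shows "p ^ n dvd x"
  using assms(3)
proof (induction n arbitrary: x)
  case (Suc n)
  then have "p dvd x * y" by (metis dvd_mult_left power_Suc)
  then have "p dvd x" using prime_elem_dvd_multD[OF assms(1)] assms(2) by blast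
  then obtain x' where x': "x = p * x'" by (elim dvdE)
  have "p \<noteq> 0" using assms(1) by (simp add: prime_elem_def)
  then have "p ^ n dvd x' * y" using Suc.prems by (simp add: x' mult.assoc)
  then have "p ^ n dvd x'" by (rule Suc.IH)
  then show ?case using x' by simp
qed simp

text \<open>Primes are removed one at a time: if \<open>p ^ n\<close> does not divide
  \<open>c\<close>, then \<open>p\<close> divides \<open>g ^ n\<close>, hence \<open>g\<close>, and
  cancelling powers of \<open>p\<close> leaves the hypothesis for the remaining factors. It serves
  both \<open>R\<close> and K[X].\<close>

lemma dvd_if_powers_dvd:
  fixes c g :: "'b::idom"
  assumes "\<forall>x\<in>#A. prime_elem x \<and> (\<exists>n. \<not> x ^ n dvd c)"
    and "\<And>n. prod_mset A ^ n dvd c * g ^ n"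
  shows "prod_mset A dvd g"
  using assms
proof (induction A arbitrary: g)
  case (add p A)
  then have p: "prime_elem p" by simp
  obtain n where n: "\<not> p ^ n dvd c" using add.prems(1) by auto
  have "p ^ n dvd c * g ^ n"
    using add.prems(2)[of n] by (simp add: power_mult_distrib dvd_mult_left)
  then have "p dvd g ^ n"
    using n prime_power_dvd_multD[OF p] by blast
  then have "p dvd g" by (rule prime_elem_dvd_power[OF p])
  then obtain g' where g': "g = p * g'" by (elim dvdE)
  have "prod_mset A ^ n dvd c * g' ^ n" for n
  proof -
    have "p ^ n * prod_mset A ^ n dvd p ^ n * (c * g' ^ n)"
      using add.prems(2)[of n] by (simp add: g' power_mult_distrib mult.left_commute)
    then show ?thesis using p by (simp add: prime_elem_def)
  qed
  then have "prod_mset A dvd g'" using add.IH add.prems(1) by simp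
  then show ?case using g' by simp
qed simp

text \<open>Each prime can be cancelled from \<open>x\<close> or from its cofactor; \<open>C\<close>
  collects those cancelled from \<open>x\<close>.\<close>

lemma dvd_prod_mset_primes:
  fixes x :: "'b::idom"
  assumes "\<forall>p\<in>#B. prime_elem p" "x dvd prod_mset B"
  shows "\<exists>C u. C \<subseteq># B \<and> u dvd 1 \<and> x = u * prod_mset C"
  using assms
proof (induction B arbitrary: x)
  case empty
  then show ?case by auto
next
  case (add p B)
  then have p: "prime_elem p" by simp
  then have p0: "p \<noteq> 0" by auto
  obtain y where y: "p * prod_mset B = x * y" using add.prems(2) by auto
  then have "p dvd x \<or> p dvd y" using p by (metis dvd_triv_left prime_elem_dvd_multD)
  then show ?case
  proof
    assume "p dvd x"
    then obtain x' where x': "x = p * x'" by (elim dvdE)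
    then have "x' dvd prod_mset B" using y p0 by (simp add: mult.assoc)
    then obtain C u where "C \<subseteq># B" "u dvd 1" "x' = u * prod_mset C"
      using add.IH[of x'] add.prems(1) by auto
    then show ?thesis
      by (intro exI[of _ "add_mset p C"] exI[of _ u]) (auto simp: x' mult_ac)
  next
    assume "p dvd y"
    then obtain y' where "y = p * y'" by (elim dvdE)
    then have "x dvd prod_mset B" using y p0 by (simp add: mult.left_commute)
    then obtain C u where "C \<subseteq># B" "u dvd 1" "x = u * prod_mset C"
      using add.IH[of x] add.prems(1) by auto
    moreover from this have "C \<subseteq># add_mset p B"
      using subset_mset.order_trans[of C B "add_mset p B"] by simp
    ultimately show ?thesis by blast
  qed
qed

text \<open>The unit is the leading coefficient; the primes are those of the monic
  associate.\<close>

lemma field_poly_prime_factorization: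
  fixes h :: "'b::field poly"
  assumes "h \<noteq> 0"
  shows "\<exists>A u. (\<forall>q\<in>#A. prime_elem q) \<and> u dvd 1 \<and> h = u * prod_mset A"
proof -
  have "\<exists>A. prod_mset A = smult (inverse (lead_coeff h)) h \<and> (\<forall>q\<in>#A. prime_elem q)"
    by (intro exI conjI ballI, rule field_poly_prod_mset_prime_factorization[OF assms],
        erule field_poly_in_prime_factorization_imp_prime)
  then obtain A where A: "prod_mset A = smult (inverse (lead_coeff h)) h" "\<forall>q\<in>#A. prime_elem q"
    by blast
  then have "h = [:lead_coeff h:] * prod_mset A" using assms by simp
  moreover have "[:lead_coeff h:] dvd 1" using assms by (simp add: is_unit_pCons_iff)
  ultimately show ?thesis using A(2) by blast
qed

lemma set_mset_repeat_mset_subset: "set_mset (repeat_mset m A) \<subseteq> set_mset A"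
  by (induction m) auto

lemma prod_mset_repeat_mset: "prod_mset (repeat_mset m A) = prod_mset A ^ m"
  for A :: "'b::comm_monoid_mult multiset"
  by (induction m) auto

lemma prod_power_prod:
  fixes u :: "nat \<Rightarrow> 'b::comm_semiring_1"
  assumes "finite S"
  shows "(\<Prod>j\<le>k. (u j * (\<Prod>q\<in>S. q ^ n j q)) ^ t j) =
    (\<Prod>j\<le>k. u j ^ t j) * (\<Prod>q\<in>S. q ^ (\<Sum>j\<le>k. n j q * t j))"
proof -
  have "(\<Prod>j\<le>k. (\<Prod>q\<in>S. q ^ n j q) ^ t j) = (\<Prod>j\<le>k. \<Prod>q\<in>S. q ^ (n j q * t j))"
    by (simp add: prod_power_distrib power_mult)
  also have "\<dots> = (\<Prod>q\<in>S. \<Prod>j\<le>k. q ^ (n j q * t j))" by (rule prod.swap)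
  finally show ?thesis by (simp add: power_mult_distrib prod.distrib power_sum)
qed

text \<open>Up to constants each \<open>x k\<close> is an exponent vector over the finite set of
  prime factors of \<open>f\<close>, so finitely many of them are linearly dependent. Coefficients
  of opposite sign go to opposite sides. The positive coefficient at the last index \<open>k\<close>
  later singles out \<open>x k\<close>.\<close>

lemma field_poly_multiplicative_dependence:
  fixes x :: "nat \<Rightarrow> 'b::field poly"
  assumes f: "f \<noteq> 0" and x: "\<And>k. x k dvd f ^ m k"
  shows "\<exists>k s a. a \<noteq> 0 \<and> (0::int) < s k \<and>
    (\<Prod>j\<le>k. x j ^ nat (s j)) = smult a (\<Prod>j\<le>k. x j ^ nat (- s j))"
proof -
  obtain A u where A: "\<forall>q\<in>#A. prime_elem q" "u dvd 1" "f = u * prod_mset A"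
    using field_poly_prime_factorization[OF f] by blast
  define S where "S = set_mset A"
  have "\<exists>n v. v dvd 1 \<and> x k = v * (\<Prod>q\<in>S. q ^ n q)" for k
  proof -
    have "u ^ m k dvd 1" using A(2) by (metis dvd_power_same power_one)
    then have "f ^ m k dvd prod_mset (repeat_mset (m k) A)"
      using mult_dvd_mono[of "u ^ m k" 1 "prod_mset A ^ m k"]
      by (simp add: A(3) power_mult_distrib prod_mset_repeat_mset)
    then have "x k dvd prod_mset (repeat_mset (m k) A)" using x dvd_trans by blast
    moreover have "\<forall>q\<in>#repeat_mset (m k) A. prime_elem q"
      using A(1) set_mset_repeat_mset_subset[of "m k" A] by (meson subsetD)
    ultimately obtain C v where C: "C \<subseteq># repeat_mset (m k) A" "v dvd 1" "x k = v * prod_mset C"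
      using dvd_prod_mset_primes[of "repeat_mset (m k) A" "x k"] by auto
    have "set_mset C \<subseteq> S"
      using set_mset_mono[OF C(1)] set_mset_repeat_mset_subset[of "m k" A] by (simp add: S_def)
    then have "prod_mset C = (\<Prod>q\<in>S. q ^ count C q)"
      unfolding prod_mset_multiplicity
    proof (rule prod.mono_neutral_left[rotated])
      show "\<forall>q\<in>S - set_mset C. q ^ count C q = 1" by (simp add: not_in_iff)
    qed (simp add: S_def)
    then show ?thesis using C(2,3) by (intro exI[of _ "count C"] exI[of _ v]) simp
  qed
  then obtain n v where nv: "\<And>k. v k dvd 1" "\<And>k. x k = v k * (\<Prod>q\<in>S. q ^ n k q)" by metis
  obtain s0 where s0: "\<exists>i\<in>{..card S}. s0 i \<noteq> 0"
      "\<forall>q\<in>S. (\<Sum>i\<in>{..card S}. s0 i * int (n i q)) = 0"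
    using int_linear_dependence[of S "{..card S}" "\<lambda>k q. int (n k q)"] by (auto simp: S_def)
  define K where "K = {i. i \<le> card S \<and> s0 i \<noteq> 0}"
  \<comment> \<open>The last index with a nonzero coefficient, so cutting the relation at
    \<open>k\<close> loses nothing; \<open>s\<close> then makes this coefficient positive.\<close>
  define k where "k = Max K"
  have K: "finite K" "K \<noteq> {}" using s0(1) by (auto simp: K_def)
  have kK: "k \<in> K" and kmax: "\<And>i. i \<in> K \<Longrightarrow> i \<le> k" using K by (auto simp: k_def)
  define s where "s i = sgn (s0 k) * s0 i" for i
  have zero: "(\<Sum>i\<le>k. s i * int (n i q)) = 0" if "q \<in> S" for q
  proof -
    have "(\<Sum>i\<le>k. s0 i * int (n i q)) = (\<Sum>i\<in>{..card S}. s0 i * int (n i q))"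
      using kK kmax by (intro sum.mono_neutral_left) (fastforce simp: K_def)+
    then show ?thesis using s0(2) that by (simp add: s_def mult.assoc flip: sum_distrib_left)
  qed
  \<comment> \<open>Over the integers, \<open>nat (s i)\<close> minus \<open>nat (- s i)\<close> is
    \<open>s i\<close>.\<close>
  have diff: "int (\<Sum>i\<le>k. n i q * nat (s i)) - int (\<Sum>i\<le>k. n i q * nat (- s i)) =
      (\<Sum>i\<le>k. s i * int (n i q))" for q
    by (simp flip: sum_subtractf) (intro sum.cong, auto simp: nat_def mult.commute)
  have ex: "(\<Sum>i\<le>k. n i q * nat (s i)) = (\<Sum>i\<le>k. n i q * nat (- s i))" if "q \<in> S" for q
  proof -
    have "int (\<Sum>i\<le>k. n i q * nat (s i)) = int (\<Sum>i\<le>k. n i q * nat (- s i))"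
      using diff[of q] unfolding zero[OF that] by (rule eq_iff_diff_eq_0[THEN iffD2])
    then show ?thesis by (simp only: of_nat_eq_iff)
  qed
  define W where "W = (\<Prod>q\<in>S. q ^ (\<Sum>i\<le>k. n i q * nat (s i)))"
  define V where "V t = (\<Prod>j\<le>k. v j ^ t j)" for t :: "nat \<Rightarrow> nat"
  have P: "(\<Prod>j\<le>k. x j ^ nat (s j)) = V (\<lambda>j. nat (s j)) * W"
    unfolding nv(2) W_def V_def by (rule prod_power_prod) (simp add: S_def)
  have "(\<Prod>j\<le>k. x j ^ nat (- s j)) =
      V (\<lambda>j. nat (- s j)) * (\<Prod>q\<in>S. q ^ (\<Sum>i\<le>k. n i q * nat (- s i)))"
    unfolding nv(2) V_def by (rule prod_power_prod) (simp add: S_def)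
  then have N: "(\<Prod>j\<le>k. x j ^ nat (- s j)) = V (\<lambda>j. nat (- s j)) * W"
    unfolding W_def using ex by simp
  have "\<exists>c. c \<noteq> 0 \<and> V t = [:c:]" for t
  proof -
    have "v j ^ t j dvd 1" for j using dvd_power_same[OF nv(1), of j "t j"] by simp
    then have "(\<Prod>j\<le>k. v j ^ t j) dvd (\<Prod>j\<le>k. 1)" by (intro prod_dvd_prod)
    then have "V t dvd 1" by (simp add: V_def)
    then show ?thesis by (elim is_unit_polyE) auto
  qed
  then obtain c where c: "\<And>t. c t \<noteq> 0" "\<And>t. V t = [:c t:]" by metis
  have "(\<Prod>j\<le>k. x j ^ nat (s j)) =
      smult (c (\<lambda>j. nat (s j)) / c (\<lambda>j. nat (- s j))) (\<Prod>j\<le>k. x j ^ nat (- s j))"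
    unfolding P N c(2) using c(1) by simp
  moreover have "s k > 0" using kK by (simp add: s_def K_def sgn_if)
  ultimately show ?thesis using c(1) by (intro exI[of _ k] exI[of _ s] exI conjI) auto
qed

section \<open>Integer-valued polynomials\<close>

definition const :: "'a::idom \<Rightarrow> 'a fract poly" where
  "const r = [:to_fract r:]"

text \<open>This is the expression inside \<open>fixed_divisor_exponent\<close>, so the exponents
  there are minima of valuations of \<open>val g c\<close>.\<close>

definition val :: "'a::idom fract poly \<Rightarrow> 'a \<Rightarrow> 'a" where
  "val g c = the_inv to_fract (poly g (to_fract c))"

lemma inj_to_fract: "inj (to_fract :: 'a::idom \<Rightarrow> 'a fract)"
  by (simp add: inj_def)

lemma to_fract_power: "to_fract (x ^ n) = to_fract x ^ n"
  by (induction n) simp_all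

lemma fract_cases:
  fixes k :: "'a::idom fract"
  obtains a b where "b \<noteq> 0" "k = to_fract a / to_fract b"
  by (cases k) (metis Fract_conv_to_fract)

lemma to_fract_div_mem_range:
  "b \<noteq> 0 \<Longrightarrow> to_fract a / to_fract b \<in> range to_fract \<longleftrightarrow> b dvd a"
  by (auto simp: divide_eq_eq dvd_def mult.commute simp flip: to_fract_mult)

lemma to_fract_val: "g \<in> int_valued \<Longrightarrow> to_fract (val g c) = poly g (to_fract c)"
  unfolding val_def by (rule f_the_inv_into_f[OF inj_to_fract]) (simp add: int_valued_def)

lemma val_eqI: "poly g (to_fract c) = to_fract r \<Longrightarrow> val g c = r"
  unfolding val_def by (simp add: the_inv_f_f[OF inj_to_fract])

lemma int_valued_mult: "g \<in> int_valued \<Longrightarrow> h \<in> int_valued \<Longrightarrow> g * h \<in> int_valued"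
proof -
  assume gh: "g \<in> int_valued" "h \<in> int_valued"
  have "poly (g * h) (to_fract c) = to_fract (val g c * val h c)" for c
    using gh by (simp add: to_fract_val)
  then show ?thesis unfolding int_valued_def by blast
qed

lemma int_valued_const: "const r \<in> int_valued"
  by (simp add: int_valued_def const_def)

lemma const_mult: "const (r * s) = const r * const s"
  by (simp add: const_def)

lemma const_one [simp]: "const 1 = 1"
  by (simp add: const_def one_pCons)

lemma const_power: "const (r ^ n) = const r ^ n"
  by (induction n) (simp_all add: const_mult)

lemma const_eq_iff [simp]: "const r = const s \<longleftrightarrow> r = s"
  by (simp add: const_def)

lemma const_eq_0_iff [simp]: "const r = 0 \<longleftrightarrow> r = 0"
  by (simp add: const_def)

lemma int_valued_one: "1 \<in> int_valued"
  using int_valued_const[of 1] by simp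

lemma int_valued_power: "g \<in> int_valued \<Longrightarrow> g ^ n \<in> int_valued"
  by (induction n) (simp_all add: int_valued_one int_valued_mult)

lemma val_mult: "g \<in> int_valued \<Longrightarrow> h \<in> int_valued \<Longrightarrow> val (g * h) c = val g c * val h c"
  by (rule val_eqI) (simp add: to_fract_val)

lemma val_const [simp]: "val (const r) c = r"
  by (rule val_eqI) (simp add: const_def)

lemma val_one [simp]: "val 1 c = 1"
  using val_const[of 1] by simp

lemma val_power: "g \<in> int_valued \<Longrightarrow> val (g ^ n) c = val g c ^ n"
  by (rule val_eqI) (simp add: to_fract_val to_fract_power)

lemma int_valued_divide_const:
  assumes "g \<in> int_valued" "r \<noteq> 0" "\<And>c. r dvd val g c"
  obtains h where "h \<in> int_valued" "g = const r * h"
proof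
  let ?h = "smult (inverse (to_fract r)) g"
  show "g = const r * ?h" using assms(2) by (simp add: const_def)
  have "poly g (to_fract c) / to_fract r \<in> range to_fract" for c
    unfolding to_fract_val[OF assms(1), symmetric] to_fract_div_mem_range[OF assms(2)]
    by (rule assms(3))
  then show "?h \<in> int_valued" by (simp add: int_valued_def field_simps)
qed

text \<open>The powers of \<open>p\<close> are pairwise distinct. Infinitude of \<open>R\<close> is
  what makes nonzero polynomials take nonzero values on it.\<close>

lemma infinite_UNIV_of_prime:
  assumes "prime_elem (p :: 'a::idom)"
  shows "infinite (UNIV :: 'a set)"
proof -
  have p: "p \<noteq> 0" "\<not> p dvd 1" using assms by (auto simp: prime_elem_def)
  have "inj (\<lambda>n. p ^ n)"
  proof (rule linorder_injI)
    fix m n :: nat assume "m < n"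
    then obtain k where k: "n = m + Suc k" using less_iff_Suc_add by auto
    show "p ^ m \<noteq> p ^ n"
    proof
      assume "p ^ m = p ^ n"
      then have "p ^ m * 1 = p ^ m * (p * p ^ k)" by (simp add: k power_add)
      then have "1 = p * p ^ k" using p(1) by (subst (asm) mult_left_cancel) auto
      then show False using p(2) by (metis dvd_triv_left)
    qed
  qed
  then show ?thesis using finite_imageD[of "\<lambda>n. p ^ n" UNIV] finite_subset[OF subset_UNIV]
    infinite_UNIV_nat by blast
qed

lemma exists_val_nonzero:
  assumes "infinite (UNIV :: 'a set)" "(g :: 'a::idom fract poly) \<noteq> 0"
  shows "\<exists>c. poly g (to_fract c) \<noteq> 0"
proof (rule ccontr)
  assume "\<not> ?thesis"
  then have "range to_fract \<subseteq> {x. poly g x = 0}" by auto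
  then have "finite (range (to_fract :: 'a \<Rightarrow> _))" using poly_roots_finite[OF assms(2)] finite_subset by blast
  then show False using assms(1) finite_imageD[OF _ inj_to_fract] by blast
qed

subsection \<open>Complete integral closedness\<close>

lemma poly_common_denominator:
  fixes y :: "'a::idom fract poly"
  shows "\<exists>d w. d \<noteq> 0 \<and> smult (to_fract d) y = map_poly to_fract w"
proof (induction y)
  case 0
  show ?case by (intro exI[of _ 1] exI[of _ 0]) simp
next
  case (pCons a y)
  then obtain d w where dw: "d \<noteq> 0" "smult (to_fract d) y = map_poly to_fract w" by blast
  obtain m e where me: "e \<noteq> 0" "a = to_fract m / to_fract e" by (rule fract_cases)
  have "smult (to_fract (d * e)) (pCons a y) = map_poly to_fract (pCons (d * m) (smult e w))"
    using me dw(2) by (simp add: map_poly_pCons flip: dw(2)) (simp add: mult.commute)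
  then show ?case using me(1) dw(1) by (metis mult_eq_0_iff)
qed

lemma poly_map_poly_to_fract: "poly (map_poly to_fract w) (to_fract c) = to_fract (poly w c)"
  by (induction w) (simp_all add: map_poly_pCons)

lemma diff_dvd_poly_diff: "x - y dvd poly w x - poly w y" for x y :: "'a::idom"
proof (induction w)
  case (pCons a w)
  have "poly (pCons a w) x - poly (pCons a w) y = x * (poly w x - poly w y) + (x - y) * poly w y"
    by (simp add: algebra_simps)
  then show ?case using pCons.IH by (simp del: poly_pCons)
qed simp

text \<open>For a common denominator \<open>d\<close> of \<open>y\<close>, the values at
  \<open>r\<close> and \<open>r + d * t\<close> differ by an element of \<open>R\<close>. The
  progression \<open>r + d * t\<close> is infinite, so it leaves \<open>S\<close>, and integrality
  there carries over to \<open>r\<close>.\<close>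

lemma int_valued_if_cofinite:
  fixes y :: "'a::idom fract poly"
  assumes inf: "infinite (UNIV :: 'a set)" and S: "finite S"
    and y: "\<And>r. r \<notin> S \<Longrightarrow> poly y (to_fract r) \<in> range to_fract"
  shows "y \<in> int_valued"
proof -
  obtain d w where d: "d \<noteq> 0" "smult (to_fract d) y = map_poly to_fract w"
    using poly_common_denominator by blast
  have pw: "to_fract d * poly y (to_fract r) = to_fract (poly w r)" for r
    by (metis d(2) poly_map_poly_to_fract poly_smult)
  have "poly y (to_fract r) \<in> range to_fract" for r
  proof -
    have "inj (\<lambda>t. r + d * t)" using d(1) by (simp add: inj_def)
    then have "infinite (range (\<lambda>t. r + d * t))" using inf finite_imageD by blast
    then have "\<not> range (\<lambda>t. r + d * t) \<subseteq> S" using finite_subset[OF _ S] by metis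
    then obtain t where t: "r + d * t \<notin> S" by auto
    obtain v where v: "poly y (to_fract (r + d * t)) = to_fract v" using y[OF t] by blast
    have "(r + d * t) - r dvd poly w (r + d * t) - poly w r" by (rule diff_dvd_poly_diff)
    then obtain q where "poly w (r + d * t) - poly w r = d * t * q" by (auto elim: dvdE)
    then have "to_fract (poly w (r + d * t)) - to_fract (poly w r) = to_fract d * to_fract (t * q)"
      by (simp add: mult.assoc flip: to_fract_diff)
    then have "to_fract d * (to_fract v - poly y (to_fract r)) = to_fract d * to_fract (t * q)"
      unfolding right_diff_distrib v[symmetric] pw .
    then have "to_fract v - poly y (to_fract r) = to_fract (t * q)"
      using d(1) by (simp only: mult_cancel_left to_fract_eq_0_iff simp_thms)
    then have "poly y (to_fract r) = to_fract (v - t * q)" by (simp add: algebra_simps)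
    then show ?thesis by blast
  qed
  then show ?thesis by (simp add: int_valued_def)
qed

text \<open>Complete integral closedness of a factorial domain, for the fraction of \<open>a\<close>
  by \<open>b\<close>: each prime factor of \<open>b\<close> has finite multiplicity in
  \<open>c\<close>.\<close>

lemma factorial_dvd_if_powers_dvd:
  fixes a b c :: "'a::{factorial_semiring,idom}"
  assumes "b \<noteq> 0" "c \<noteq> 0" "\<And>n. b ^ n dvd c * a ^ n"
  shows "b dvd a"
proof -
  obtain A where A: "\<forall>x\<in>#A. prime_elem x" "normalize (prod_mset A) = normalize b"
    using prime_factorization_exists[OF assms(1)] by blast
  have Ab: "prod_mset A dvd b" "b dvd prod_mset A"
    using associatedD1[OF A(2)] associatedD2[OF A(2)] by auto
  have "\<exists>n. \<not> x ^ n dvd c" if "x \<in># A" for x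
  proof -
    have "\<not> x dvd 1" using A(1) that by (auto simp: prime_elem_def)
    then have "\<not> x ^ Suc (multiplicity x c) dvd c"
      using power_dvd_iff_le_multiplicity[of c x "Suc (multiplicity x c)"] assms(2) by simp
    then show ?thesis by blast
  qed
  moreover have "prod_mset A ^ n dvd c * a ^ n" for n
    using dvd_trans[OF dvd_power_same[OF Ab(1)] assms(3)] .
  ultimately have "prod_mset A dvd a" using A(1) dvd_if_powers_dvd[of A c a] by blast
  then show ?thesis using Ab(2) dvd_trans by blast
qed

text \<open>The analogue in K[X]: the degree of \<open>c\<close> bounds the powers of a prime that
  divide it.\<close>

lemma field_poly_dvd_if_powers_dvd:
  fixes g h c :: "'b::field poly"
  assumes "h \<noteq> 0" "c \<noteq> 0" "\<And>n. h ^ n dvd c * g ^ n"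
  shows "h dvd g"
proof -
  obtain A u where A: "\<forall>q\<in>#A. prime_elem q" "u dvd 1" "h = u * prod_mset A"
    using field_poly_prime_factorization[OF assms(1)] by blast
  have "\<not> q ^ Suc (degree c) dvd c" if "q \<in># A" for q
  proof
    have q: "q \<noteq> 0" "\<not> q dvd 1" using A(1) that by (auto simp: prime_elem_def)
    then have "degree q \<noteq> 0" by (metis is_unit_iff_degree)
    assume "q ^ Suc (degree c) dvd c"
    then have "Suc (degree c) * degree q \<le> degree c"
      using dvd_imp_degree_le[of "q ^ Suc (degree c)" c] assms(2) degree_power_eq[OF q(1)] by metis
    then show False using \<open>degree q \<noteq> 0\<close> by (cases "degree q") auto
  qed
  moreover have "prod_mset A ^ n dvd c * g ^ n" for n
    using dvd_trans[OF dvd_power_same[of "prod_mset A" h n] assms(3)[of n]] A(3) by simp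
  ultimately have "prod_mset A dvd g" using A(1) dvd_if_powers_dvd[of A c g] by blast
  then show ?thesis using A(2,3) by (metis mult_dvd_mono mult_1_left)
qed

subsection \<open>The monoid of divisors of powers of an integer-valued polynomial\<close>

lemma div_closed_int_valued: "g \<in> div_closed f \<Longrightarrow> g \<in> int_valued"
  and div_closed_nonzero: "g \<in> div_closed f \<Longrightarrow> g \<noteq> 0"
  by (auto simp: div_closed_def)

lemma div_closedI:
  "f ^ k = g * h \<Longrightarrow> g \<in> int_valued \<Longrightarrow> h \<in> int_valued \<Longrightarrow> g \<noteq> 0 \<Longrightarrow> g \<in> div_closed f"
  by (auto simp: div_closed_def)

lemma div_closedE:
  assumes "g \<in> div_closed f"
  obtains k h where "f ^ k = g * h" "h \<in> int_valued"
  using assms by (auto simp: div_closed_def)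

lemma div_closed_one: "1 \<in> div_closed f"
  by (rule div_closedI[of f 0 1 1]) (simp_all add: int_valued_one)

lemma div_closed_mult:
  assumes "g \<in> div_closed f" "h \<in> div_closed f" shows "g * h \<in> div_closed f"
proof -
  obtain k s where s: "f ^ k = g * s" "s \<in> int_valued" using assms(1) by (rule div_closedE)
  obtain l t where t: "f ^ l = h * t" "t \<in> int_valued" using assms(2) by (rule div_closedE)
  have "f ^ (k + l) = (g * h) * (s * t)" by (simp add: power_add s t mult_ac)
  then show ?thesis
    by (rule div_closedI)
      (use assms s(2) t(2) in \<open>simp_all add: int_valued_mult div_closed_int_valued div_closed_nonzero\<close>)
qed

text \<open>Both factors divide the same power of \<open>f\<close>. Hence divisibility between
  members of the monoid is the same as in \<open>Int(R)\<close>.\<close>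

lemma div_closed_factor:
  assumes "g * h \<in> div_closed f" "g \<in> int_valued" "h \<in> int_valued"
  shows "g \<in> div_closed f" "h \<in> div_closed f"
proof -
  obtain k s where s: "f ^ k = g * h * s" "s \<in> int_valued" using assms(1) by (rule div_closedE)
  have nz: "g \<noteq> 0" "h \<noteq> 0" using div_closed_nonzero[OF assms(1)] by auto
  have "f ^ k = g * (h * s)" "f ^ k = h * (g * s)" by (simp_all add: s(1) mult_ac)
  then show "g \<in> div_closed f" "h \<in> div_closed f"
    using div_closedI[of f k g "h * s"] div_closedI[of f k h "g * s"] nz assms(2,3) s(2)
    by (simp_all add: int_valued_mult)
qed

lemma div_closed_power: "g \<in> div_closed f \<Longrightarrow> g ^ n \<in> div_closed f"
  by (induction n) (simp_all add: div_closed_one div_closed_mult)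

lemma mem_div_closed_monoid [simp]: "to_fract g \<in> div_closed_monoid f \<longleftrightarrow> g \<in> div_closed f"
  by (auto simp: div_closed_monoid_def)

lemma div_closed_monoidE:
  assumes "x \<in> div_closed_monoid f" obtains g where "g \<in> div_closed f" "x = to_fract g"
  using assms by (auto simp: div_closed_monoid_def)

lemma mem_coset_div_closed_monoid:
  "to_fract g \<in> to_fract a *o div_closed_monoid f \<longleftrightarrow> (\<exists>h\<in>div_closed f. g = a * h)"
  by (auto simp: elt_set_times_def div_closed_monoid_def simp flip: to_fract_mult)

lemma mem_const_coset_iff:
  assumes "g \<in> div_closed f" "r \<noteq> 0"
  shows "to_fract g \<in> to_fract (const r) *o div_closed_monoid f \<longleftrightarrow> (\<forall>c. r dvd val g c)"
proof
  assume "to_fract g \<in> to_fract (const r) *o div_closed_monoid f"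
  then obtain h where "h \<in> div_closed f" "g = const r * h"
    unfolding mem_coset_div_closed_monoid by blast
  then show "\<forall>c. r dvd val g c"
    by (simp add: val_mult int_valued_const div_closed_int_valued)
next
  assume "\<forall>c. r dvd val g c"
  then obtain h where h: "h \<in> int_valued" "g = const r * h"
    using int_valued_divide_const[OF div_closed_int_valued[OF assms(1)] assms(2)] by blast
  then have "h \<in> div_closed f" using div_closed_factor(2) assms(1) int_valued_const by blast
  then show "to_fract g \<in> to_fract (const r) *o div_closed_monoid f"
    unfolding mem_coset_div_closed_monoid using h(2) by blast
qed

lemma field_monoid_div_closed_monoid: "field_monoid (div_closed_monoid f)"
proof
  show "1 \<in> div_closed_monoid f"
    using div_closed_one by (metis mem_div_closed_monoid to_fract_1)
  show "a * b \<in> div_closed_monoid f" if "a \<in> div_closed_monoid f" "b \<in> div_closed_monoid f" for a b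
    using that by (elim div_closed_monoidE) (simp add: div_closed_mult flip: to_fract_mult)
  show "0 \<notin> div_closed_monoid f"
    using div_closed_nonzero[of 0 f] by (auto elim!: div_closed_monoidE)
qed

section \<open>Complete integral closedness of the monoid\<close>

lemma is_unit_if_no_prime:
  fixes x :: "'a::{factorial_semiring,idom}"
  assumes "\<not> (\<exists>p::'a. prime_elem p)" "x \<noteq> 0" shows "x dvd 1"
  using no_prime_divisors_imp_unit[OF assms(2)] assms(1) by blast

text \<open>Where \<open>c\<close> does not vanish, complete integral closedness of \<open>R\<close>
  makes the value of \<open>y\<close> integral; the finitely many roots of \<open>c\<close> are
  covered by integrality elsewhere.\<close>

lemma int_valued_if_almost_integral:
  fixes y c :: "'a::{factorial_semiring,idom} fract poly"
  assumes c: "c \<noteq> 0" and cy: "\<And>n. c * y ^ n \<in> int_valued"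
  shows "y \<in> int_valued"
proof (cases "\<exists>p::'a. prime_elem p")
  case True
  then have inf: "infinite (UNIV :: 'a set)" using infinite_UNIV_of_prime by blast
  define S where "S = {r. poly c (to_fract r) = 0}"
  have "finite (to_fract ` S)"
    by (rule finite_subset[OF _ poly_roots_finite[OF c]]) (auto simp: S_def)
  then have "finite S" using finite_imageD inj_on_subset[OF inj_to_fract] by blast
  moreover have "poly y (to_fract r) \<in> range to_fract" if r: "r \<notin> S" for r
  proof -
    obtain a b where ab: "b \<noteq> 0" "poly y (to_fract r) = to_fract a / to_fract b" by (rule fract_cases)
    have c0: "c \<in> int_valued" using cy[of 0] by simp
    have "val c r \<noteq> 0" using r to_fract_val[OF c0, of r] by (auto simp: S_def)
    moreover have "b ^ n dvd val c r * a ^ n" for n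
    proof -
      have "to_fract (val c r * a ^ n) / to_fract (b ^ n) = poly (c * y ^ n) (to_fract r)"
        by (simp add: to_fract_val[OF c0] ab(2) to_fract_power power_divide)
      also have "\<dots> \<in> range to_fract" using cy[of n] by (auto simp: int_valued_def)
      finally show ?thesis using ab(1) by (simp add: to_fract_div_mem_range del: to_fract_mult)
    qed
    ultimately have "b dvd a" using factorial_dvd_if_powers_dvd ab(1) by blast
    then show ?thesis unfolding ab(2) using to_fract_div_mem_range ab(1) by blast
  qed
  ultimately show ?thesis using int_valued_if_cofinite[OF inf] by blast
next
  case False
  \<comment> \<open>Without primes every nonzero element of \<open>R\<close> is a unit, so
    \<open>R\<close> fills its fraction field.\<close>
  have "k \<in> range to_fract" for k :: "'a fract"
  proof -
    obtain a b where ab: "b \<noteq> 0" "k = to_fract a / to_fract b" by (rule fract_cases)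
    have "b dvd a" using is_unit_if_no_prime[OF False ab(1)] dvd_trans one_dvd by blast
    then show ?thesis unfolding ab(2) using to_fract_div_mem_range ab(1) by blast
  qed
  then show ?thesis by (simp add: int_valued_def)
qed

text \<open>Two closedness properties in succession: that of K[X] turns the fraction
  \<open>z\<close> into a polynomial \<open>y\<close>, that of \<open>Int(R)\<close> makes
  \<open>y\<close> integer-valued. As a factor of \<open>g\<close> it then lies in the
  monoid.\<close>

lemma cic_monoid_div_closed_monoid:
  fixes f :: "'a::{factorial_semiring,idom} fract poly"
  shows "cic_monoid (div_closed_monoid f)"
proof (intro cic_monoid.intro field_monoid_div_closed_monoid cic_monoid_axioms.intro)
  fix z c assume z: "z \<in> quotient_group (div_closed_monoid f)" and c: "c \<in> div_closed_monoid f"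
    and cz: "\<And>n. c * z ^ n \<in> div_closed_monoid f"
  obtain g h where gh: "g \<in> div_closed f" "h \<in> div_closed f" "z = to_fract g / to_fract h"
    using z by (auto simp: quotient_group_def elim!: div_closed_monoidE)
  obtain c0 where c0: "c0 \<in> div_closed f" "c = to_fract c0" using c by (rule div_closed_monoidE)
  have h0: "h \<noteq> 0" using gh(2) by (rule div_closed_nonzero)
  have ex: "\<exists>t\<in>div_closed f. c * z ^ n = to_fract t" for n using cz[of n] by (auto elim: div_closed_monoidE)
  have "h ^ n dvd c0 * g ^ n" for n
  proof -
    obtain t where t: "c * z ^ n = to_fract t" using ex by blast
    have "to_fract (c0 * g ^ n) = to_fract (t * h ^ n)"
      using t h0 by (simp add: c0(2) gh(3) power_divide to_fract_power divide_eq_eq)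
    then have "c0 * g ^ n = t * h ^ n" by (simp only: to_fract_eq_iff)
    then show ?thesis by simp
  qed
  then have "h dvd g" by (rule field_poly_dvd_if_powers_dvd[OF h0 div_closed_nonzero[OF c0(1)]])
  then obtain y where y: "g = h * y" by (elim dvdE)
  have zy: "z = to_fract y" using h0 by (simp add: gh(3) y)
  have "c0 * y ^ n \<in> int_valued" for n
  proof -
    obtain t where t: "t \<in> div_closed f" "c * z ^ n = to_fract t" using ex by blast
    have "to_fract (c0 * y ^ n) = to_fract t" using t(2) by (simp add: c0(2) zy to_fract_power)
    then show ?thesis using t(1) div_closed_int_valued by (simp only: to_fract_eq_iff)
  qed
  then have "y \<in> int_valued" by (rule int_valued_if_almost_integral[OF div_closed_nonzero[OF c0(1)]])
  then have "y \<in> div_closed f"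
    using div_closed_factor(2)[of h y f] gh(1) y div_closed_int_valued[OF gh(2)] by simp
  then show "z \<in> div_closed_monoid f" by (simp add: zy)
qed

subsection \<open>Associated primes of constant primes\<close>

lemma prod_in_int_valued:
  "(\<And>j. j \<in> J \<Longrightarrow> x j \<in> int_valued) \<Longrightarrow> (\<Prod>j\<in>J. x j) \<in> int_valued"
  by (induction J rule: infinite_finite_induct) (simp_all add: int_valued_one int_valued_mult)

lemma val_prod:
  "(\<And>j. j \<in> J \<Longrightarrow> x j \<in> int_valued) \<Longrightarrow> val (\<Prod>j\<in>J. x j) c = (\<Prod>j\<in>J. val (x j) c)"
  by (induction J rule: infinite_finite_induct) (simp_all add: val_mult prod_in_int_valued)

lemma prime_elem_dvd_prod_power:
  fixes p :: "'a::idom" and x :: "nat \<Rightarrow> 'a"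
  assumes p: "prime_elem p" and dv: "p dvd (\<Prod>j\<le>k. x j ^ t j)"
  shows "\<exists>j\<le>k. t j \<noteq> 0 \<and> p dvd x j"
proof -
  have "\<exists>j\<in>J. p dvd y j" if "finite J" "p dvd (\<Prod>j\<in>J. y j)" for J :: "nat set" and y
    using that
  proof (induction J rule: finite_induct)
    case empty
    then show ?case using p by (simp add: prime_elem_def)
  next
    case (insert i J)
    then have "p dvd y i \<or> p dvd (\<Prod>j\<in>J. y j)" by (simp add: prime_elem_dvd_mult_iff[OF p])
    then show ?case using insert.IH by blast
  qed
  from this[OF _ dv] obtain j where j: "j \<le> k" "p dvd x j ^ t j" by auto
  have "t j \<noteq> 0" using j(2) p by (auto simp: prime_elem_def intro!: gr0I)
  then show ?thesis using j prime_elem_dvd_power[OF p j(2)] by blast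
qed

text \<open>The ideals \<open>{x. p dvd b * x}\<close> satisfy the ascending chain condition: along a strictly
  ascending chain, the successive factors are multiplicatively independent modulo constants, and
  in \<open>K[X]\<close> they only involve the finitely many prime factors of \<open>f\<close>.\<close>

lemma exists_associated_prime:
  fixes f :: "'a::{factorial_semiring,idom} fract poly"
  defines "pdvd \<equiv> \<lambda>p g. \<forall>c. p dvd val g c"
  assumes p: "prime_elem p" and f: "f \<noteq> 0"
  shows "\<exists>b\<in>div_closed f. \<not> pdvd p b \<and> (\<forall>x\<in>div_closed f. \<forall>y\<in>div_closed f.
           \<not> pdvd p (b * x) \<longrightarrow> pdvd p (b * x * y) \<longrightarrow> pdvd p (b * y))"
proof (rule ccontr)
  assume no: "\<not> ?thesis"
  \<comment> \<open>Each admissible \<open>b\<close> has a pair violating primality. Passing to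
    \<open>b * x\<close> enlarges the ideal, with \<open>y\<close> as a new element, and keeps
    \<open>b\<close> admissible, so the construction can be iterated.\<close>
  have "\<forall>b. \<exists>x y. b \<in> div_closed f \<and> \<not> pdvd p b \<longrightarrow> x \<in> div_closed f \<and> y \<in> div_closed f \<and>
      \<not> pdvd p (b * x) \<and> pdvd p (b * x * y) \<and> \<not> pdvd p (b * y)"
    using no by metis
  then obtain X Y where XY: "\<And>b. b \<in> div_closed f \<Longrightarrow> \<not> pdvd p b \<Longrightarrow> X b \<in> div_closed f \<and>
      Y b \<in> div_closed f \<and> \<not> pdvd p (b * X b) \<and> pdvd p (b * X b * Y b) \<and> \<not> pdvd p (b * Y b)"
    by metis
  define b where "b = rec_nat 1 (\<lambda>_ b. b * X b)"
  have b0: "b 0 = 1" and bS: "b (Suc n) = b n * X (b n)" for n by (simp_all add: b_def)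
  have p1: "\<not> p dvd 1" using p by (simp add: prime_elem_def)
  have b: "b n \<in> div_closed f \<and> \<not> pdvd p (b n)" for n
  proof (induction n)
    case 0
    show ?case using p1 by (simp add: b0 div_closed_one pdvd_def)
  next
    case (Suc n)
    then show ?case using XY[of "b n"] by (simp add: bS div_closed_mult)
  qed
  define x where "x n = X (b n)" for n
  define y where "y n = Y (b n)" for n
  have x: "x n \<in> div_closed f" and y: "y n \<in> div_closed f"
    and bxy: "pdvd p (b n * x n * y n)" and by_ndvd: "\<not> pdvd p (b n * y n)" for n
    using XY[of "b n"] b[of n] by (simp_all add: x_def y_def)
  note iv = div_closed_int_valued[OF x] div_closed_int_valued[OF y] div_closed_int_valued
  have biv: "b n \<in> int_valued" for n using b div_closed_int_valued by blast
  have val_b: "val (b n) c = (\<Prod>j<n. val (x j) c)" for n c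
    by (induction n) (simp_all add: b0 bS val_mult biv iv flip: x_def)
  have "\<exists>m. x k dvd f ^ m" for k
    using x[of k] by (elim div_closedE) (metis dvd_triv_left)
  then obtain m where "\<And>k. x k dvd f ^ m k" by metis
  then obtain k s a where rel: "a \<noteq> 0" "(0::int) < s k"
      "(\<Prod>j\<le>k. x j ^ nat (s j)) = smult a (\<Prod>j\<le>k. x j ^ nat (- s j))"
    using field_poly_multiplicative_dependence[OF f, of x m] by blast
  define P where "P c = (\<Prod>j\<le>k. val (x j) c ^ nat (s j))" for c
  define N where "N c = (\<Prod>j\<le>k. val (x j) c ^ nat (- s j))" for c
  obtain num den where nd: "den \<noteq> 0" "a = to_fract num / to_fract den" by (rule fract_cases)
  have num0: "num \<noteq> 0" using rel(1) nd by auto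
  have PN: "den * P c = num * N c" for c
  proof -
    have "const den * (\<Prod>j\<le>k. x j ^ nat (s j)) = const num * (\<Prod>j\<le>k. x j ^ nat (- s j))"
      unfolding rel(3) using nd by (simp add: const_def)
    then have "val (const den * (\<Prod>j\<le>k. x j ^ nat (s j))) c =
        val (const num * (\<Prod>j\<le>k. x j ^ nat (- s j))) c" by simp
    then show ?thesis
      by (simp add: val_mult val_prod val_power int_valued_const prod_in_int_valued
          int_valued_power iv P_def N_def)
  qed
  \<comment> \<open>At \<open>c1\<close>, \<open>p\<close> divides \<open>x k\<close> but no earlier
    factor: it divides neither \<open>b k\<close> nor \<open>y k\<close> there, yet it divides
    \<open>b k * x k * y k\<close>.\<close>
  obtain c1 where c1: "\<not> p dvd val (b k * y k) c1" using by_ndvd unfolding pdvd_def by blast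
  \<comment> \<open>At \<open>c2\<close> no \<open>x j\<close> with \<open>j \<le> k\<close> is
    divisible by \<open>p\<close>, since \<open>b (Suc k)\<close> is their product.\<close>
  obtain c2 where c2: "\<not> p dvd val (b (Suc k)) c2" using b[of "Suc k"] unfolding pdvd_def by blast
  have c1b: "\<not> p dvd val (b k) c1" "\<not> p dvd val (y k) c1"
    using c1 by (auto simp: val_mult biv iv)
  have c1x: "\<not> p dvd val (x j) c1" if "j < k" for j
    using c1b(1) that dvd_prodI[of "{..<k}" j "\<lambda>j. val (x j) c1"] dvd_trans[of p "val (x j) c1"]
    by (auto simp: val_b)
  have c2x: "\<not> p dvd val (x j) c2" if "j \<le> k" for j
    using c2 that dvd_prodI[of "{..<Suc k}" j "\<lambda>j. val (x j) c2"] dvd_trans[of p "val (x j) c2"]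
    by (auto simp: val_b simp del: prod.lessThan_Suc)
  have "p dvd val (b k * x k * y k) c1" using bxy[of k] unfolding pdvd_def by blast
  then have "p dvd val (b k) c1 * val (x k) c1 * val (y k) c1"
    by (simp add: val_mult biv iv int_valued_mult)
  then have "p dvd val (x k) c1"
    using c1b p by (simp add: prime_elem_dvd_mult_iff)
  then have "p dvd val (x k) c1 ^ nat (s k)"
    using rel(2) dvd_trans[OF _ dvd_power[of "nat (s k)" "val (x k) c1"]] by simp
  moreover have "val (x k) c1 ^ nat (s k) dvd P c1" unfolding P_def by (rule dvd_prodI) auto
  ultimately have pP: "p dvd P c1" by (rule dvd_trans)
  have pN: "\<not> p dvd N c1"
  proof
    assume "p dvd N c1"
    then have "\<exists>j\<le>k. nat (- s j) \<noteq> 0 \<and> p dvd val (x j) c1"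
      unfolding N_def by (rule prime_elem_dvd_prod_power[OF p])
    then obtain j where j: "j \<le> k" "nat (- s j) \<noteq> 0" "p dvd val (x j) c1" by blast
    then show False using c1x[of j] rel(2) by (cases "j = k") auto
  qed
  have c2P: "\<not> p dvd P c2"
    unfolding P_def using c2x by (auto dest!: prime_elem_dvd_prod_power[OF p])
  \<comment> \<open>The relation \<open>den * P c = num * N c\<close> has the same constants at
    every point. At \<open>c1\<close> it forces \<open>p ^ Suc v\<close> into \<open>num\<close>,
    and at \<open>c2\<close> it carries this power back to \<open>den\<close>.\<close>
  define v where "v = multiplicity p den"
  have v: "p ^ v dvd den" "\<not> p ^ Suc v dvd den"
    using power_dvd_iff_le_multiplicity[of den p] nd(1) p1 by (simp_all add: v_def del: power_Suc)
  have "p ^ Suc v dvd den * P c1" using mult_dvd_mono[OF pP v(1)] by (simp add: mult.commute)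
  then have "p ^ Suc v dvd num * N c1" by (simp only: PN)
  then have "p ^ Suc v dvd num" by (rule prime_power_dvd_multD[OF p pN])
  then have "p ^ Suc v dvd num * N c2" by (rule dvd_mult2)
  then have "p ^ Suc v dvd den * P c2" by (simp only: PN)
  then have "p ^ Suc v dvd den" by (rule prime_power_dvd_multD[OF p c2P])
  then show False using v(2) by simp
qed

text \<open>Degrees add, so both factors are constants, and integer-valued constants come from
  \<open>R\<close>.\<close>

lemma factor_of_const:
  assumes "const r = g * h" "r \<noteq> 0" "g \<in> int_valued" "h \<in> int_valued"
  obtains s t where "g = const s" "h = const t" "r = s * t"
proof -
  have "g \<noteq> 0" "h \<noteq> 0" using assms(1,2) by auto
  have "degree (g * h) = 0" by (simp flip: assms(1) add: const_def)
  then have "degree g = 0" "degree h = 0" using \<open>g \<noteq> 0\<close> \<open>h \<noteq> 0\<close> by (simp_all add: degree_mult_eq)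
  then obtain k l where kl: "g = [:k:]" "h = [:l:]" by (metis degree_eq_zeroE)
  have "k \<in> range to_fract" "l \<in> range to_fract"
    using assms(3,4) by (auto simp: int_valued_def kl)
  then obtain s t where "g = const s" "h = const t" by (auto simp: kl const_def)
  moreover from this have "r = s * t" using assms(1) by (simp flip: const_mult)
  ultimately show ?thesis using that by blast
qed

text \<open>If \<open>p\<close> does not divide \<open>r\<close>, all of \<open>p ^ n\<close>
  divides the cofactor, which leaves \<open>r\<close> invertible.\<close>

lemma prime_dvd_nonunit_factor_of_power:
  fixes p :: "'a::idom"
  assumes p: "prime_elem p" and r: "\<not> r dvd 1" "r dvd p ^ n"
  shows "p dvd r"
proof (rule ccontr)
  assume np: "\<not> p dvd r"
  obtain s where s: "p ^ n = r * s" using r(2) by (elim dvdE)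
  then have "p ^ n dvd s * r" by (simp add: mult.commute)
  then have "p ^ n dvd s" by (rule prime_power_dvd_multD[OF p np])
  then obtain t where "s = p ^ n * t" by (elim dvdE)
  then have "p ^ n * 1 = p ^ n * (r * t)" using s by (simp add: mult_ac)
  then have "1 = r * t" using p by (subst (asm) mult_left_cancel) (auto simp: prime_elem_def)
  then show False using r(1) by (metis dvd_triv_left)
qed

section \<open>From divisorial powers or a finite class group to prime elements\<close>

lemma const_prime_elements:
  fixes f :: "'a::{factorial_semiring,idom} fract poly"
  defines "H \<equiv> div_closed_monoid f"
  assumes f: "f \<noteq> 0" and p: "prime_elem p" and pf: "const p \<in> div_closed f"
    and alt: "finite (carrier (v_class_group H)) \<or>
      (\<forall>P\<in>minimal_primes H. P \<inter> constants \<noteq> {} \<longrightarrow>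
        (\<exists>n::nat. n \<ge> 1 \<and> principal_ideal H (v_closure H (P ^ n))))"
  shows "to_fract (const p) \<in> prime_elements H"
proof -
  interpret cic_monoid H unfolding H_def by (rule cic_monoid_div_closed_monoid)
  have p0: "p \<noteq> 0" using p by (simp add: prime_elem_def)
  note coset = mem_const_coset_iff[OF _ p0, of _ f, folded H_def]
  obtain b where b: "b \<in> div_closed f" "\<not> (\<forall>c. p dvd val b c)"
    "\<And>x y. x \<in> div_closed f \<Longrightarrow> y \<in> div_closed f \<Longrightarrow> \<not> (\<forall>c. p dvd val (b * x) c) \<Longrightarrow>
       (\<forall>c. p dvd val (b * x * y) c) \<Longrightarrow> (\<forall>c. p dvd val (b * y) c)"
    using exists_associated_prime[OF p f] by blast
  show ?thesis
  proof (rule prime_element_of_associated_prime[where b = "to_fract b"])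
    show "to_fract (const p) \<in> H" "to_fract b \<in> H" using pf b(1) by (simp_all add: H_def)
    show "to_fract b \<notin> to_fract (const p) *o H" using coset[OF b(1)] b(2) by simp
  next
    fix x n assume x: "x \<in> H" "x ^ n \<in> to_fract (const p) *o H"
    then obtain g where g: "g \<in> div_closed f" "x = to_fract g"
      unfolding H_def by (elim div_closed_monoidE)
    have "to_fract (g ^ n) \<in> to_fract (const p) *o H" using x(2) by (simp add: g(2) to_fract_power)
    then have "p dvd val g c ^ n" for c
      using coset[OF div_closed_power[OF g(1)]] val_power[OF div_closed_int_valued[OF g(1)]] by simp
    then have "p dvd val g c" for c using prime_elem_dvd_power[OF p] by blast
    then show "x \<in> to_fract (const p) *o H" using coset[OF g(1)] g(2) by simp
  next
    fix a n assume a: "a \<in> H" "to_fract (const p) ^ n \<in> a *o H" "1 \<notin> a *o H"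
    then obtain g where g: "g \<in> div_closed f" "a = to_fract g"
      unfolding H_def by (elim div_closed_monoidE)
    have "to_fract (const (p ^ n)) \<in> to_fract g *o H" using a(2) by (simp add: g(2) to_fract_power const_power)
    then obtain h where h: "h \<in> div_closed f" "const (p ^ n) = g * h"
      unfolding H_def mem_coset_div_closed_monoid by blast
    obtain s t where st: "g = const s" "p ^ n = s * t"
      using factor_of_const[OF h(2) _ div_closed_int_valued[OF g(1)] div_closed_int_valued[OF h(1)]] p0
      by (metis power_not_zero)
    \<comment> \<open>An inverse of \<open>s\<close> in \<open>R\<close> is again a constant of the
      monoid, so it would make \<open>a\<close> a unit there.\<close>
    have "\<not> s dvd 1"
    proof
      assume "s dvd 1"
      then obtain s' where s': "1 = s * s'" by (elim dvdE)
      have eq: "const s * const s' = 1" by (simp flip: const_mult s')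
      then have "const s' \<in> div_closed f"
        using div_closed_factor(2)[of "const s" "const s'" f] int_valued_const div_closed_one by auto
      then have "1 \<in> a *o H"
        using eq unfolding g(2) st(1) H_def
        by (metis mem_coset_div_closed_monoid to_fract_1)
      then show False using a(3) by simp
    qed
    then have "p dvd s" using prime_dvd_nonunit_factor_of_power[OF p, of s n] st(2) by simp
    then show "a \<in> to_fract (const p) *o H" using coset[OF g(1)] by (simp add: g(2) st(1))
  next
    fix x y assume xy: "x \<in> H" "y \<in> H" "to_fract b * x \<notin> to_fract (const p) *o H"
      "to_fract b * x * y \<in> to_fract (const p) *o H"
    obtain g where g: "g \<in> div_closed f" "x = to_fract g"
      using xy(1) unfolding H_def by (rule div_closed_monoidE)
    obtain h where h: "h \<in> div_closed f" "y = to_fract h"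
      using xy(2) unfolding H_def by (rule div_closed_monoidE)
    have 1: "\<not> (\<forall>c. p dvd val (b * g) c)"
      using xy(3) coset[OF div_closed_mult[OF b(1) g(1)]] by (simp add: g(2))
    have 2: "\<forall>c. p dvd val (b * g * h) c"
      using xy(4) coset[OF div_closed_mult[OF div_closed_mult[OF b(1) g(1)] h(1)]] by (simp add: g(2) h(2))
    show "to_fract b * y \<in> to_fract (const p) *o H"
      using b(3)[OF g(1) h(1) 1 2] coset[OF div_closed_mult[OF b(1) h(1)]] by (simp add: h(2))
  next
    have "to_fract (const p) \<in> constants" by (auto simp: constants_def const_def)
    then show "finite (carrier (v_class_group H)) \<or>
      (\<forall>P\<in>minimal_primes H. to_fract (const p) \<in> P \<longrightarrow>
        (\<exists>n::nat. n \<ge> 1 \<and> principal_ideal H (v_closure H (P ^ n))))"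
      using alt by blast
  qed
qed

subsection \<open>Constant atoms\<close>

lemma const_dvd_mem:
  assumes "r dvd s" "const s \<in> div_closed f" shows "const r \<in> div_closed f"
proof -
  obtain t where "s = r * t" using assms(1) by (elim dvdE)
  then show ?thesis
    using assms(2) div_closed_factor(1)[of "const r" "const t" f] by (simp add: const_mult int_valued_const)
qed

text \<open>Units of \<open>R\<close> divide \<open>1 = f ^ 0\<close>.\<close>

lemma const_unit_mem: "r dvd 1 \<Longrightarrow> const r \<in> div_closed f"
  using const_dvd_mem[of r 1 f] by (simp add: div_closed_one)

lemma const_mem_Units_iff:
  assumes "const r \<in> div_closed f"
  shows "to_fract (const r) \<in> Units (mult_monoid (div_closed_monoid f)) \<longleftrightarrow> r dvd 1"
proof
  assume "to_fract (const r) \<in> Units (mult_monoid (div_closed_monoid f))"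
  then obtain x where "x \<in> div_closed_monoid f" "to_fract (const r) * x = 1"
    by (auto simp: Units_def mult_monoid_def mult.commute)
  then obtain g where g: "g \<in> div_closed f" "to_fract (const r * g) = to_fract 1"
    by (elim div_closed_monoidE) auto
  then have "const 1 = const r * g" by (simp only: to_fract_eq_iff const_one)
  then obtain t where "1 = r * t"
    using factor_of_const[of 1 "const r" g] int_valued_const[of r] div_closed_int_valued[OF g(1)]
    by (metis const_eq_iff one_neq_zero)
  then show "r dvd 1" by (metis dvd_triv_left)
next
  assume "r dvd 1"
  then obtain s where s: "1 = r * s" by (elim dvdE)
  then have "s dvd 1" by (metis dvd_triv_right)
  then have "const s \<in> div_closed f" by (rule const_unit_mem)
  moreover have "to_fract (const r) * to_fract (const s) = 1"
    by (metis s const_mult const_one to_fract_1 to_fract_mult)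
  ultimately show "to_fract (const r) \<in> Units (mult_monoid (div_closed_monoid f))"
    using assms by (auto simp: Units_def mult_monoid_def mult.commute intro!: bexI[of _ "to_fract (const s)"])
qed

lemma const_divides_iff:
  assumes "const s \<in> div_closed f" "r \<noteq> 0"
  shows "to_fract (const r) divides\<^bsub>mult_monoid (div_closed_monoid f)\<^esub> to_fract (const s) \<longleftrightarrow> r dvd s"
proof -
  have "to_fract (const r) divides\<^bsub>mult_monoid (div_closed_monoid f)\<^esub> to_fract (const s) \<longleftrightarrow>
      to_fract (const s) \<in> to_fract (const r) *o div_closed_monoid f"
    by (auto simp: factor_def mult_monoid_def elt_set_times_def)
  then show ?thesis using mem_const_coset_iff[OF assms] by simp
qed

text \<open>Divisors of constants are constants, so constant atoms are irreducible in
  \<open>R\<close>, hence prime there. For the forward direction, a prime divisor of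
  \<open>r\<close> not associated to \<open>r\<close> would be a proper factor and hence a
  unit.\<close>

lemma const_mem_atoms_iff:
  fixes f :: "'a::{factorial_semiring,idom} fract poly"
  assumes "const r \<in> div_closed f"
  shows "to_fract (const r) \<in> atoms (div_closed_monoid f) \<longleftrightarrow> prime_elem r"
proof
  let ?G = "mult_monoid (div_closed_monoid f)"
  have r0: "r \<noteq> 0" using div_closed_nonzero[OF assms] by simp
  {
    assume "to_fract (const r) \<in> atoms (div_closed_monoid f)"
    then have irr: "Divisibility.irreducible ?G (to_fract (const r))" by (simp add: atoms_def)
    then have "\<not> r dvd 1"
      using const_mem_Units_iff[OF assms] by (auto simp: Divisibility.irreducible_def)
    then obtain p where p: "prime p" "p dvd r" using r0 by (elim prime_divisorE)
    have pf: "const p \<in> div_closed f" by (rule const_dvd_mem[OF p(2) assms])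
    have p0: "p \<noteq> 0" "\<not> p dvd 1" using p(1) by auto
    have "r dvd p"
    proof (rule ccontr)
      assume "\<not> r dvd p"
      then have "properfactor ?G (to_fract (const p)) (to_fract (const r))"
        using p p0 r0 const_divides_iff[OF assms p0(1)] const_divides_iff[OF pf r0]
        by (simp add: properfactor_def)
      then have "to_fract (const p) \<in> Units ?G"
        using irr pf by (auto simp: Divisibility.irreducible_def mult_monoid_def)
      then show False using const_mem_Units_iff[OF pf] p0(2) by simp
    qed
    then have "normalize r = normalize p" by (rule normalization_semidom_class.associatedI[OF _ p(2)])
    then show "prime_elem r" using p(1) prime_elem_normalize_iff prime_def by metis
  }
  {
    assume p: "prime_elem r"
    show "to_fract (const r) \<in> atoms (div_closed_monoid f)"
      unfolding atoms_def Divisibility.irreducible_def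
    proof (intro CollectI conjI ballI impI)
      show "to_fract (const r) \<in> div_closed_monoid f" using assms by simp
      show "to_fract (const r) \<notin> Units ?G" using const_mem_Units_iff[OF assms] p by (simp add: prime_elem_def)
      fix x assume x: "x \<in> carrier ?G" "properfactor ?G x (to_fract (const r))"
      then obtain g where g: "g \<in> div_closed f" "x = to_fract g"
        by (auto simp: mult_monoid_def elim: div_closed_monoidE)
      obtain h where h: "h \<in> div_closed f" "to_fract (const r) = to_fract (g * h)"
        using x(2) by (auto simp: g(2) properfactor_def factor_def mult_monoid_def elim!: div_closed_monoidE)
      obtain s t where st: "g = const s" "h = const t" "r = s * t"
        using factor_of_const[of r g h] h(2) r0 div_closed_int_valued g(1) h(1) to_fract_eq_iff by metis
      have sf: "const s \<in> div_closed f" using g(1) st(1) by simp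
      have s0: "s \<noteq> 0" using r0 st(3) by auto
      have "\<not> r dvd s"
        using x(2) const_divides_iff[OF sf r0] by (simp add: properfactor_def g(2) st(1))
      then have "r dvd t" using prime_elem_dvd_multD[OF p, of s t] st(3) by simp
      then obtain w where "t = r * w" by (elim dvdE)
      then have "r * 1 = r * (s * w)" using st(3) by (simp add: mult_ac)
      then have "1 = s * w" using r0 by (subst (asm) mult_left_cancel) auto
      then have "s dvd 1" by (metis dvd_triv_left)
      then show "x \<in> Units ?G" using const_mem_Units_iff[OF sf] by (simp add: g(2) st(1))
    qed
  }
qed

text \<open>The prime factors of \<open>r\<close> lie in the monoid, and a prime ideal containing
  their product contains one of them.\<close>

lemma const_prime_in_prime_ideal:
  fixes f :: "'a::{factorial_semiring,idom} fract poly"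
  assumes P: "prime_s_ideal (div_closed_monoid f) P" and r: "to_fract (const r) \<in> P"
  shows "\<exists>p. prime_elem p \<and> to_fract (const p) \<in> P"
proof -
  interpret field_monoid "div_closed_monoid f" by (rule field_monoid_div_closed_monoid)
  note Pp = P[unfolded prime_s_ideal_iff]
  show ?thesis
    using r
  proof (induction r rule: prime_divisors_induct)
    case zero
    then have "const 0 \<in> div_closed f" using Pp by auto
    then show ?case using div_closed_nonzero by fastforce
  next
    case (unit x)
    then obtain y where y: "1 = x * y" by (elim dvdE)
    then have "to_fract (const y) \<in> div_closed_monoid f"
      using const_unit_mem[of y f] by (metis dvd_triv_right mem_div_closed_monoid)
    then have "to_fract (const x) * to_fract (const y) \<in> P" using Pp unit(2) by blast
    moreover have "to_fract (const x) * to_fract (const y) = 1"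
      by (metis y const_mult const_one to_fract_1 to_fract_mult)
    ultimately show ?case using Pp by auto
  next
    case (factor p x)
    have "const (p * x) \<in> div_closed f" using Pp factor.prems by auto
    then have "const p \<in> div_closed f" "const x \<in> div_closed f"
      using const_dvd_mem[of p "p * x" f] const_dvd_mem[of x "p * x" f] by simp_all
    moreover have "to_fract (const p) * to_fract (const x) \<in> P"
      using factor.prems by (simp add: const_mult)
    ultimately have "to_fract (const p) \<in> P \<or> to_fract (const x) \<in> P" using Pp by simp
    then show ?case using factor.IH factor.hyps prime_imp_prime_elem by blast
  qed
qed

text \<open>Expresses primality through values, the form that can be compared with fixed divisor
  exponents.\<close>

lemma const_mem_prime_elements_iff:
  fixes f :: "'a::{factorial_semiring,idom} fract poly"
  assumes p: "prime_elem p" and pf: "const p \<in> div_closed f"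
  shows "to_fract (const p) \<in> prime_elements (div_closed_monoid f) \<longleftrightarrow>
    (\<forall>x\<in>div_closed f. \<forall>y\<in>div_closed f. (\<forall>c. p dvd val (x * y) c) \<longrightarrow>
      (\<forall>c. p dvd val x c) \<or> (\<forall>c. p dvd val y c))"
proof -
  interpret field_monoid "div_closed_monoid f" by (rule field_monoid_div_closed_monoid)
  have p0: "p \<noteq> 0" "\<not> p dvd 1" using p by (auto simp: prime_elem_def)
  let ?H = "div_closed_monoid f" and ?I = "to_fract (const p) *o div_closed_monoid f"
  note coset = mem_const_coset_iff[OF _ p0(1), of _ f]
  have "1 \<notin> ?I" using coset[OF div_closed_one] p0(2) by simp
  moreover have "?I \<subseteq> ?H" "\<forall>x\<in>?I. \<forall>h\<in>?H. x * h \<in> ?I"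
    using pf by (auto simp: elt_set_times_def mult.assoc)
  moreover have "(\<forall>x\<in>?H. \<forall>y\<in>?H. x * y \<in> ?I \<longrightarrow> x \<in> ?I \<or> y \<in> ?I) \<longleftrightarrow>
    (\<forall>x\<in>div_closed f. \<forall>y\<in>div_closed f. to_fract (x * y) \<in> ?I \<longrightarrow> to_fract x \<in> ?I \<or> to_fract y \<in> ?I)"
    unfolding div_closed_monoid_def[of f] by simp
  ultimately show ?thesis
    unfolding prime_elements_iff prime_s_ideal_iff using pf
    by (simp add: coset div_closed_mult del: to_fract_mult)
qed

subsection \<open>Fixed divisors\<close>

text \<open>At \<open>x = 0\<close> both sides hold, because the valuation is then infinite.\<close>

lemma le_valuation_iff:
  assumes "prime_elem p"
  shows "enat k \<le> valuation p x \<longleftrightarrow> p ^ k dvd x"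
  using assms power_dvd_iff_le_multiplicity[of x p k] by (simp add: valuation_def prime_elem_def)

text \<open>Some value of \<open>g\<close> is nonzero, which keeps the infimum finite, so
  \<open>the_enat\<close> returns the minimum itself.\<close>

lemma le_fixed_divisor_exponent_iff:
  fixes g :: "'a::{factorial_semiring,idom} fract poly"
  assumes p: "prime_elem p" and g: "g \<in> int_valued" "g \<noteq> 0"
  shows "k \<le> fixed_divisor_exponent p g \<longleftrightarrow> (\<forall>c. p ^ k dvd val g c)"
proof -
  obtain c where "poly g (to_fract c) \<noteq> 0"
    using exists_val_nonzero[OF infinite_UNIV_of_prime[OF p] g(2)] by blast
  then have "val g c \<noteq> 0" using to_fract_val[OF g(1), of c] by auto
  then have "valuation p (val g c) \<noteq> \<infinity>" by (simp add: valuation_def)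
  moreover have "(INF c. valuation p (val g c)) \<le> valuation p (val g c)" by (rule INF_lower) simp
  ultimately obtain n where n: "(INF c. valuation p (val g c)) = enat n"
    by (cases "INF c. valuation p (val g c)") auto
  then have "fixed_divisor_exponent p g = n" by (simp add: fixed_divisor_exponent_def flip: val_def)
  then have "k \<le> fixed_divisor_exponent p g \<longleftrightarrow> enat k \<le> (INF c. valuation p (val g c))"
    using n by simp
  also have "\<dots> \<longleftrightarrow> (\<forall>c. p ^ k dvd val g c)"
    by (simp add: le_INF_iff le_valuation_iff[OF p])
  finally show ?thesis .
qed

text \<open>Splitting off the full powers of \<open>p\<close> from \<open>g\<close> and
  \<open>h\<close> leaves factors that \<open>p\<close> does not divide. Primality of
  \<open>const p\<close> gives a value of their product prime to \<open>p\<close>, so the exponent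
  of \<open>g * h\<close> is no larger than the sum.\<close>

lemma fixed_divisor_exponent_mult:
  fixes f :: "'a::{factorial_semiring,idom} fract poly"
  assumes p: "prime_elem p" and g: "g \<in> div_closed f" and h: "h \<in> div_closed f"
    and pr: "const p \<in> div_closed f \<Longrightarrow> to_fract (const p) \<in> prime_elements (div_closed_monoid f)"
  shows "fixed_divisor_exponent p (g * h) = fixed_divisor_exponent p g + fixed_divisor_exponent p h"
proof -
  note le = le_fixed_divisor_exponent_iff[OF p div_closed_int_valued div_closed_nonzero]
  have p0: "p \<noteq> 0" using p by (simp add: prime_elem_def)
  have split: "\<exists>x'\<in>div_closed f. x = const (p ^ k) * x' \<and> const (p ^ k) \<in> div_closed f"
    if x: "x \<in> div_closed f" "k \<le> fixed_divisor_exponent p x" for x k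
  proof -
    have "p ^ k dvd val x c" for c using le[OF x(1) x(1)] x(2) by blast
    then obtain x' where x': "x' \<in> int_valued" "x = const (p ^ k) * x'"
      using int_valued_divide_const[OF div_closed_int_valued[OF x(1)], of "p ^ k"] p0 by auto
    then show ?thesis using div_closed_factor[of "const (p ^ k)" x' f] x(1) int_valued_const by blast
  qed
  show ?thesis
  proof (cases "const p \<in> div_closed f")
    case False
    \<comment> \<open>A positive exponent would split off \<open>const p\<close> and place it in the
      monoid.\<close>
    have "fixed_divisor_exponent p x = 0" if "x \<in> div_closed f" for x
    proof (rule ccontr)
      assume "fixed_divisor_exponent p x \<noteq> 0"
      then show False using split[OF that, of 1] False by auto
    qed
    then show ?thesis using g h div_closed_mult[OF g h] by simp
  next
    case True
    define m n where "m = fixed_divisor_exponent p g" and "n = fixed_divisor_exponent p h"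
    have nd: "\<not> (\<forall>c. p dvd val x' c)"
      if x: "x \<in> div_closed f" "x' \<in> div_closed f" "x = const (p ^ fixed_divisor_exponent p x) * x'" for x x'
    proof
      assume "\<forall>c. p dvd val x' c"
      then have "p ^ fixed_divisor_exponent p x * p dvd p ^ fixed_divisor_exponent p x * val x' c" for c
        by (intro mult_dvd_mono) simp_all
      then have "p ^ Suc (fixed_divisor_exponent p x) dvd val x c" for c
        by (subst x(3)) (simp add: val_mult int_valued_const div_closed_int_valued[OF x(2)] mult.commute)
      then have "Suc (fixed_divisor_exponent p x) \<le> fixed_divisor_exponent p x"
        using le[OF x(1) x(1)] by blast
      then show False by simp
    qed
    obtain g' where g': "g' \<in> div_closed f" "g = const (p ^ m) * g'" using split[OF g] m_def by blast
    obtain h' where h': "h' \<in> div_closed f" "h = const (p ^ n) * h'" using split[OF h] n_def by blast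
    have "\<not> (\<forall>c. p dvd val (g' * h') c)"
      using pr[OF True] nd[OF g g'(1) g'(2)[unfolded m_def]] nd[OF h h'(1) h'(2)[unfolded n_def]] g'(1) h'(1)
      unfolding const_mem_prime_elements_iff[OF p True] by blast
    then obtain c where c: "\<not> p dvd val (g' * h') c" by blast
    have vgh: "val (g * h) c = p ^ (m + n) * val (g' * h') c" for c
      by (simp add: g'(2) h'(2) val_mult int_valued_mult int_valued_const power_add mult_ac
          div_closed_int_valued[OF g'(1)] div_closed_int_valued[OF h'(1)])
    have gh: "g * h \<in> div_closed f" using g h by (rule div_closed_mult)
    have "m + n \<le> fixed_divisor_exponent p (g * h)" using le[OF gh gh] vgh by simp
    moreover have "\<not> p ^ (m + n) * p dvd p ^ (m + n) * val (g' * h') c" using c p0 by simp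
    then have "\<not> p ^ Suc (m + n) dvd val (g * h) c" by (simp only: vgh power_Suc2 not_False_eq_True)
    then have "\<not> Suc (m + n) \<le> fixed_divisor_exponent p (g * h)" using le[OF gh gh] by blast
    ultimately show ?thesis by (simp add: m_def n_def)
  qed
qed

section \<open>Representatives of primes and the product defining the fixed divisor\<close>

lemma prime_representatives_eq:
  fixes Q :: "'a::idom set"
  assumes Q: "prime_representatives Q" "p \<in> Q" "q \<in> Q" and dv: "p dvd q"
  shows "p = q"
proof -
  have p: "prime_elem p" and q: "prime_elem q" using Q by (auto simp: prime_representatives_def)
  obtain u where u: "q = p * u" using dv by (elim dvdE)
  have "q dvd p"
  proof (rule ccontr)
    assume "\<not> q dvd p"
    then have "q dvd u" using prime_elem_dvd_multD[OF q, of p u] u by simp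
    then obtain w where "u = q * w" by (elim dvdE)
    then have "q * 1 = q * (p * w)" using u by (simp add: mult_ac)
    then have "1 = p * w" using q by (subst (asm) mult_left_cancel) (auto simp: prime_elem_def)
    then show False using p by (metis dvd_triv_left prime_elem_def)
  qed
  have "\<exists>!r. r \<in> Q \<and> p dvd r \<and> r dvd p" using Q(1) p unfolding prime_representatives_def by simp
  then obtain r where r: "\<forall>s. s \<in> Q \<and> p dvd s \<and> s dvd p \<longrightarrow> s = r" by (elim ex1E)
  show ?thesis using r[rule_format, of p] r[rule_format, of q] Q(2,3) dv \<open>q dvd p\<close> by simp
qed

text \<open>Every prime in the support divides one fixed nonzero value of \<open>g\<close>. Members
  of \<open>Q\<close> are arbitrary associates, so they are counted through
  \<open>normalize\<close>.\<close>

lemma finite_fixed_divisor_support: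
  fixes g :: "'a::{factorial_semiring,idom} fract poly"
  assumes Q: "prime_representatives Q" and g: "g \<in> int_valued" "g \<noteq> 0"
  shows "finite {p \<in> Q. fixed_divisor_exponent p g \<noteq> 0}"
proof (cases "Q = {}")
  case False
  have pr: "prime_elem p" if "p \<in> Q" for p using Q that by (simp add: prime_representatives_def)
  then have "infinite (UNIV :: 'a set)" using False infinite_UNIV_of_prime by blast
  then obtain c where "poly g (to_fract c) \<noteq> 0" using exists_val_nonzero g(2) by blast
  then have v: "val g c \<noteq> 0" using to_fract_val[OF g(1), of c] by auto
  let ?S = "{p \<in> Q. fixed_divisor_exponent p g \<noteq> 0}"
  have "inj_on normalize ?S"
  proof (rule inj_onI)
    fix p q assume "p \<in> ?S" "q \<in> ?S" and eq: "normalize p = normalize q"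
    then have "p \<in> Q" "q \<in> Q" by simp_all
    then show "p = q" by (rule prime_representatives_eq[OF Q _ _ associatedD1[OF eq]])
  qed
  moreover have "normalize ` ?S \<subseteq> prime_factors (val g c)"
  proof
    fix x assume "x \<in> normalize ` ?S"
    then obtain p where p: "p \<in> Q" "fixed_divisor_exponent p g \<noteq> 0" "x = normalize p" by blast
    then have "p ^ 1 dvd val g c"
      using le_fixed_divisor_exponent_iff[OF pr[OF p(1)] g, of 1] by simp
    then show "x \<in> prime_factors (val g c)"
      using v pr[OF p(1)] by (simp add: p(3) in_prime_factors_iff)
  qed
  then have "finite (normalize ` ?S)" by (rule finite_subset) simp
  ultimately show ?thesis by (rule finite_imageD[rotated])
qed simp

text \<open>Allows one finite index set for several polynomials at once.\<close>

lemma fixed_divisor_eq_prod: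
  assumes "finite T" "T \<subseteq> Q" "{p \<in> Q. fixed_divisor_exponent p g \<noteq> 0} \<subseteq> T"
  shows "fixed_divisor Q g = (\<Prod>p\<in>T. p ^ fixed_divisor_exponent p g)"
  unfolding fixed_divisor_def
proof (rule prod.mono_neutral_left[OF assms(1,3)], rule ballI)
  fix p assume "p \<in> T - {p \<in> Q. fixed_divisor_exponent p g \<noteq> 0}"
  then have "fixed_divisor_exponent p g = 0" using assms(2) by blast
  then show "p ^ fixed_divisor_exponent p g = 1" by simp
qed

lemma fixed_divisor_mult:
  fixes g h :: "'a::{factorial_semiring,idom} fract poly"
  assumes Q: "prime_representatives Q" and g: "g \<in> int_valued" "g \<noteq> 0" and h: "h \<in> int_valued" "h \<noteq> 0"
    and add: "\<And>p. p \<in> Q \<Longrightarrow>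
      fixed_divisor_exponent p (g * h) = fixed_divisor_exponent p g + fixed_divisor_exponent p h"
  shows "fixed_divisor Q (g * h) = fixed_divisor Q g * fixed_divisor Q h"
proof -
  define S where "S x = {p \<in> Q. fixed_divisor_exponent p x \<noteq> 0}" for x
  define T where "T = S g \<union> S h"
  have T: "finite T" "T \<subseteq> Q"
    using finite_fixed_divisor_support[OF Q g] finite_fixed_divisor_support[OF Q h]
    by (auto simp: T_def S_def)
  have sub: "S g \<subseteq> T" "S h \<subseteq> T" "S (g * h) \<subseteq> T" using add by (auto simp: T_def S_def)
  note eq = fixed_divisor_eq_prod[OF T, folded S_def]
  have "fixed_divisor Q (g * h) = (\<Prod>p\<in>T. p ^ fixed_divisor_exponent p (g * h))"
    by (rule eq[OF sub(3)])
  also have "\<dots> = (\<Prod>p\<in>T. p ^ fixed_divisor_exponent p g * p ^ fixed_divisor_exponent p h)"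
    using T(2) add by (intro prod.cong) (auto simp: power_add)
  finally show ?thesis by (simp add: prod.distrib eq[OF sub(1)] eq[OF sub(2)])
qed

lemma fixed_divisor_nonzero:
  assumes Q: "prime_representatives Q" shows "fixed_divisor Q g \<noteq> 0"
proof
  assume "fixed_divisor Q g = 0"
  \<comment> \<open>A product over an infinite index set would be 1, so only a zero factor can make
    it vanish.\<close>
  then have "\<exists>p\<in>Q. p = 0"
    unfolding fixed_divisor_def
    by (cases "finite {p \<in> Q. fixed_divisor_exponent p g \<noteq> 0}") (auto simp del: neq0_conv)
  then show False using Q by (auto simp: prime_representatives_def prime_elem_def)
qed

text \<open>Distinct representatives do not divide each other, so only the factor at
  \<open>q\<close> contributes. The exponents are thus recoverable from the fixed divisor.\<close>

lemma multiplicity_fixed_divisor: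
  fixes g :: "'a::{factorial_semiring,idom} fract poly"
  assumes Q: "prime_representatives Q" and q: "q \<in> Q" and g: "g \<in> int_valued" "g \<noteq> 0"
  shows "multiplicity q (fixed_divisor Q g) = fixed_divisor_exponent q g"
proof -
  let ?S = "{p \<in> Q. fixed_divisor_exponent p g \<noteq> 0}"
  have pr: "prime_elem p" if "p \<in> Q" for p using Q that by (simp add: prime_representatives_def)
  have nz: "p \<noteq> 0" if "p \<in> Q" for p using pr[OF that] by (simp add: prime_elem_def)
  have fin: "finite ?S" by (rule finite_fixed_divisor_support[OF Q g])
  have "multiplicity q (fixed_divisor Q g) = (\<Sum>p\<in>?S. multiplicity q (p ^ fixed_divisor_exponent p g))"
    unfolding fixed_divisor_def
    by (rule prime_elem_multiplicity_prod_distrib[OF pr[OF q] _ fin]) (use nz in auto)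
  also have "\<dots> = (\<Sum>p\<in>?S. if p = q then fixed_divisor_exponent p g else 0)"
  proof (rule sum.cong[OF refl])
    fix p assume "p \<in> ?S"
    then have p: "p \<in> Q" by simp
    have "\<not> q dvd p" if "p \<noteq> q" using prime_representatives_eq[OF Q q p] that by metis
    then have "multiplicity q p = (if p = q then 1 else 0)"
      using pr[OF q] by (simp add: not_dvd_imp_multiplicity_0)
    then show "multiplicity q (p ^ fixed_divisor_exponent p g) =
        (if p = q then fixed_divisor_exponent p g else 0)"
      by (simp add: prime_elem_multiplicity_power_distrib[OF pr[OF q] nz[OF p]])
  qed
  also have "\<dots> = fixed_divisor_exponent q g" using fin q by simp
  finally show ?thesis .
qed

text \<open>Multiplicities at the representative \<open>q\<close> of \<open>r\<close> turn
  multiplicativity of the fixed divisor into additivity of exponents; if both exponents are zero, so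
  is that of the product.\<close>

lemma const_prime_of_fixed_divisor_mult:
  fixes f :: "'a::{factorial_semiring,idom} fract poly"
  assumes Q: "prime_representatives Q" and r: "prime_elem r" "const r \<in> div_closed f"
    and mult: "\<And>g h. g \<in> div_closed f \<Longrightarrow> h \<in> div_closed f \<Longrightarrow>
      fixed_divisor Q (g * h) = fixed_divisor Q g * fixed_divisor Q h"
  shows "to_fract (const r) \<in> prime_elements (div_closed_monoid f)"
  unfolding const_mem_prime_elements_iff[OF r]
proof (intro ballI impI)
  fix x y assume x: "x \<in> div_closed f" and y: "y \<in> div_closed f" and xy: "\<forall>c. r dvd val (x * y) c"
  obtain q where q: "q \<in> Q" "r dvd q" "q dvd r" using Q r(1) unfolding prime_representatives_def by blast
  have pq: "prime_elem q" using Q q(1) by (simp add: prime_representatives_def)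
  have rq: "r dvd z \<longleftrightarrow> q dvd z" for z using q(2,3) dvd_trans by blast
  have e: "(\<forall>c. r dvd val z c) \<longleftrightarrow> fixed_divisor_exponent q z \<noteq> 0" if "z \<in> div_closed f" for z
    using le_fixed_divisor_exponent_iff[OF pq div_closed_int_valued[OF that] div_closed_nonzero[OF that], of 1]
    by (simp add: rq Suc_le_eq)
  have m: "multiplicity q (fixed_divisor Q z) = fixed_divisor_exponent q z" if "z \<in> div_closed f" for z
    using multiplicity_fixed_divisor[OF Q q(1)] div_closed_int_valued[OF that] div_closed_nonzero[OF that] by blast
  have "fixed_divisor_exponent q (x * y) = fixed_divisor_exponent q x + fixed_divisor_exponent q y"
    using prime_elem_multiplicity_mult_distrib[OF pq fixed_divisor_nonzero[OF Q] fixed_divisor_nonzero[OF Q], of x y]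
    by (simp add: m x y div_closed_mult flip: mult[OF x y])
  then show "(\<forall>c. r dvd val x c) \<or> (\<forall>c. r dvd val y c)"
    using xy unfolding e[OF x] e[OF y] e[OF div_closed_mult[OF x y]] by simp
qed

section \<open>Equivalence of the four conditions, and the case of a finite class group\<close>

theorem proposition3p2:
  fixes f :: "'a::{factorial_semiring,idom} fract poly"
    and Q :: "'a set"
  assumes "prime_representatives Q"
    and "f \<in> int_valued" and "f \<noteq> 0"
  shows "let H = div_closed_monoid f;
             C1 = (\<forall>P\<in>minimal_primes H. P \<inter> constants \<noteq> {} \<longrightarrow> principal_ideal H P);
             C2 = (\<forall>P\<in>minimal_primes H. P \<inter> constants \<noteq> {} \<longrightarrow>
                     (\<exists>n::nat. n \<ge> 1 \<and> principal_ideal H (v_closure H (P ^ n))));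
             C3 = (\<forall>a\<in>atoms H \<inter> constants. a \<in> prime_elements H);
             C4 = (\<forall>g\<in>div_closed f. \<forall>h\<in>div_closed f.
                     fixed_divisor Q (g * h) = fixed_divisor Q g * fixed_divisor Q h)
         in (C1 \<longleftrightarrow> C2) \<and> (C2 \<longleftrightarrow> C3) \<and> (C3 \<longleftrightarrow> C4) \<and>
            (finite (carrier (v_class_group H)) \<longrightarrow> C1 \<and> C2 \<and> C3 \<and> C4)"
proof -
  define H where "H = div_closed_monoid f"
  interpret cic_monoid H unfolding H_def by (rule cic_monoid_div_closed_monoid)
  define C1 where "C1 = (\<forall>P\<in>minimal_primes H. P \<inter> constants \<noteq> {} \<longrightarrow> principal_ideal H P)"
  define C2 where "C2 = (\<forall>P\<in>minimal_primes H. P \<inter> constants \<noteq> {} \<longrightarrow>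
                     (\<exists>n::nat. n \<ge> 1 \<and> principal_ideal H (v_closure H (P ^ n))))"
  define C3 where "C3 = (\<forall>a\<in>atoms H \<inter> constants. a \<in> prime_elements H)"
  define C4 where "C4 = (\<forall>g\<in>div_closed f. \<forall>h\<in>div_closed f.
                     fixed_divisor Q (g * h) = fixed_divisor Q g * fixed_divisor Q h)"
  have constE: "\<exists>r. a = to_fract (const r)" if "a \<in> constants" for a :: "'a fract poly fract"
    using that by (auto simp: constants_def const_def)
  have const_in: "to_fract (const r) \<in> constants" for r :: 'a by (simp add: constants_def const_def)
  \<comment> \<open>The common form of the conditions, with constant atoms replaced by the primes of
    \<open>R\<close> in the monoid.\<close>
  have C3_iff: "C3 \<longleftrightarrow>
      (\<forall>p. prime_elem p \<longrightarrow> const p \<in> div_closed f \<longrightarrow> to_fract (const p) \<in> prime_elements H)"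
  proof
    assume C3
    then show "\<forall>p. prime_elem p \<longrightarrow> const p \<in> div_closed f \<longrightarrow> to_fract (const p) \<in> prime_elements H"
      using const_mem_atoms_iff[of _ f] const_in unfolding C3_def H_def by blast
  next
    assume *: "\<forall>p. prime_elem p \<longrightarrow> const p \<in> div_closed f \<longrightarrow> to_fract (const p) \<in> prime_elements H"
    show C3 unfolding C3_def
    proof
      fix a assume a: "a \<in> atoms H \<inter> constants"
      then obtain r where r: "a = to_fract (const r)" using constE by blast
      then have rf: "const r \<in> div_closed f" using a by (simp add: atoms_def H_def)
      then have "prime_elem r" using const_mem_atoms_iff[OF rf] a r by (simp add: H_def)
      then show "a \<in> prime_elements H" using * rf r by simp
    qed
  qed
  \<comment> \<open>Principal ideals are divisorial, so \<open>n = 1\<close> serves.\<close>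
  have "principal_ideal H (v_closure H (P ^ 1))" if P: "principal_ideal H P" for P
  proof -
    obtain a where a: "a \<in> H" "P = a *o H" using P by (auto simp: principal_ideal_def)
    have "v_closure H P = P"
      unfolding a(2) using a(1) subset_quotient_group by (intro v_closure_principal) blast
    then show ?thesis using P by (simp del: set_one)
  qed
  then have C12: "C1 \<Longrightarrow> C2" unfolding C1_def C2_def by (meson le_refl)
  \<comment> \<open>A finite class group and \<open>C2\<close> enter through the same alternative,
    so finiteness yields \<open>C3\<close> and with it the other conditions.\<close>
  have C23: "finite (carrier (v_class_group H)) \<or> C2 \<Longrightarrow> C3"
    using const_prime_elements[OF assms(3), folded H_def] unfolding C3_iff C2_def by blast
  have C31: "C3 \<Longrightarrow> C1"
    unfolding C1_def
  proof (intro ballI impI)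
    fix P assume C3 and P: "P \<in> minimal_primes H" "P \<inter> constants \<noteq> {}"
    obtain r where r: "to_fract (const r) \<in> P" using P(2) constE by blast
    have pP: "prime_s_ideal H P" using P(1) by (simp add: minimal_primes_def)
    obtain p where p: "prime_elem p" "to_fract (const p) \<in> P"
      using const_prime_in_prime_ideal[OF pP[unfolded H_def] r] by blast
    have "to_fract (const p) \<in> H" using p(2) pP by (auto simp: prime_s_ideal_iff)
    then have "to_fract (const p) \<in> prime_elements H"
      using \<open>C3\<close> p(1) unfolding C3_iff by (simp add: H_def)
    then show "principal_ideal H P" by (rule principal_of_prime_element[OF P(1) p(2)])
  qed
  have C34: "C4" if C3
    unfolding C4_def
  proof (intro ballI)
    fix g h assume g: "g \<in> div_closed f" and h: "h \<in> div_closed f"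
    have "fixed_divisor_exponent p (g * h) = fixed_divisor_exponent p g + fixed_divisor_exponent p h"
      if "p \<in> Q" for p
    proof -
      have "prime_elem p" using assms(1) that by (simp add: prime_representatives_def)
      then show ?thesis
        using fixed_divisor_exponent_mult[OF _ g h] \<open>C3\<close> unfolding C3_iff H_def by blast
    qed
    then show "fixed_divisor Q (g * h) = fixed_divisor Q g * fixed_divisor Q h"
      by (intro fixed_divisor_mult assms(1) div_closed_int_valued[OF g] div_closed_int_valued[OF h]
          div_closed_nonzero[OF g] div_closed_nonzero[OF h])
  qed
  have C43: "C4 \<Longrightarrow> C3"
    unfolding C3_iff C4_def H_def using const_prime_of_fixed_divisor_mult[OF assms(1)] by blast
  have "(C1 \<longleftrightarrow> C2) \<and> (C2 \<longleftrightarrow> C3) \<and> (C3 \<longleftrightarrow> C4) \<and>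
      (finite (carrier (v_class_group H)) \<longrightarrow> C1 \<and> C2 \<and> C3 \<and> C4)"
    using C12 C23 C31 C34 C43 by blast
  then show ?thesis unfolding Let_def C1_def C2_def C3_def C4_def H_def .
qed

end
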